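(* For $n,d,k\ge 3$, there exist positive constants $c_1$ and $c_2$ depending only on $k$ such that $$c_1\,\frac{d^{\frac{k}{k-1}}}{\log d}\,\log\left(\frac{n^{k-1}}{d}\right)\ \le\ \vartheta(n,d,k)\ \le\ c_2\, d^{\frac{k}{2}}\log n .$$ Moreover, if $k$ is even, the lower bound can be improved to $$\frac{c_1 d^2}{\log d}\,\log\left(\frac{n}{d}\right)\ \le\ \vartheta(n,d,k).$$
   Context: A $k$-graph $G$ is a $k$-uniform hypergraph (identified with its edge set) on a finite vertex set $V(G)$; its complement $\overline{G}$ is the $k$-graph on $V(G)$ whose edges are the $k$-subsets of $V(G)$ that are not edges of $G$. A set $I\subseteq V(G)$ is independent in $G$ if it contains no edge of $G$. $\vartheta(G)$ is the minimum $t$ such that there exist independent sets $I_1,\dots,I_t$ of $G$ with every edge of $\overline{G}$ contained in some $I_j$. $\Delta(G)$ is the maximum, over vertices $v$, of the number of edges of $G$ containing $v$. $\vartheta(n,d,k)$ is the maximum of $\vartheta(G)$ over all $k$-graphs $G$ on $n$ vertices with $\Delta(G)\le d$. *)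

theory Defs
  imports Complex_Main "HOL-Library.Ramsey"
begin

definition kgraph :: "nat \<Rightarrow> 'a set \<Rightarrow> 'a set set \<Rightarrow> bool" where
  "kgraph k V E \<longleftrightarrow> finite V \<and> E \<subseteq> nsets V k"

definition kcomplement :: "nat \<Rightarrow> 'a set \<Rightarrow> 'a set set \<Rightarrow> 'a set set" where
  "kcomplement k V E = nsets V k - E"

definition independent :: "'a set \<Rightarrow> 'a set set \<Rightarrow> 'a set \<Rightarrow> bool" where
  "independent V E I \<longleftrightarrow> I \<subseteq> V \<and> (\<forall>e\<in>E. \<not> e \<subseteq> I)"

definition covers :: "nat \<Rightarrow> 'a set \<Rightarrow> 'a set set \<Rightarrow> nat \<Rightarrow> (nat \<Rightarrow> 'a set) \<Rightarrow> bool" where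
  "covers k V E t I \<longleftrightarrow>
     (\<forall>j\<in>{1..t}. independent V E (I j)) \<and>
     (\<forall>e\<in>kcomplement k V E. \<exists>j\<in>{1..t}. e \<subseteq> I j)"

text \<open>The families \<open>I\<^sub>1, \<dots>, I\<^sub>t\<close> are nonempty, i.e. \<open>t \<ge> 1\<close>. This only matters when the
  complement has no edges, where \<open>theta\<close> is then 1 and not 0.\<close>

definition theta :: "nat \<Rightarrow> 'a set \<Rightarrow> 'a set set \<Rightarrow> nat" where
  "theta k V E = (LEAST t. t \<ge> 1 \<and> (\<exists>I. covers k V E t I))"

text \<open>Meaningful for finite nonempty \<open>V\<close> only (\<open>Max {}\<close> is unspecified).\<close>

definition max_degree :: "'a set \<Rightarrow> 'a set set \<Rightarrow> nat" where
  "max_degree V E = Max ((\<lambda>v. card {e \<in> E. v \<in> e}) ` V)"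

text \<open>Vertices are taken from \<open>nat\<close>, which covers all finite \<open>k\<close>-graphs up to isomorphism.\<close>

definition theta_values :: "nat \<Rightarrow> nat \<Rightarrow> nat \<Rightarrow> nat set" where
  "theta_values n d k =
     {theta k V E | (V :: nat set) E. kgraph k V E \<and> card V = n \<and> max_degree V E \<le> d}"

definition theta_max :: "nat \<Rightarrow> nat \<Rightarrow> nat \<Rightarrow> nat" where
  "theta_max n d k = Max (theta_values n d k)"

text \<open>The minimum and the maximum above are attained.\<close>

lemma covers_exists:
  assumes "kgraph k V E" "k \<ge> 1"
  shows "\<exists>I. covers k V E (Suc (card (kcomplement k V E))) I"
proof -
  let ?C = "kcomplement k V E"
  have fin: "finite ?C"
    using assms by (auto simp: kgraph_def kcomplement_def finite_imp_finite_nsets)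
  obtain f where f: "bij_betw f {1..card ?C} ?C"
    using ex_bij_betw_nat_finite_1[OF fin] by blast
  define I where "I = (\<lambda>j. if j \<le> card ?C then f j else {})"
  have ne: "e \<noteq> {}" if "e \<in> E" for e
    using that assms by (auto simp: kgraph_def nsets_def)
  have ind: "independent V E e" if e: "e \<in> ?C" for e
    unfolding independent_def
  proof (intro conjI ballI notI)
    show "e \<subseteq> V" using e by (auto simp: kcomplement_def nsets_def)
    fix g assume g: "g \<in> E" "g \<subseteq> e"
    then have "g = e"
      using e assms(1) by (intro card_subset_eq) (auto simp: kcomplement_def nsets_def kgraph_def)
    then show False using g e by (auto simp: kcomplement_def)
  qed
  have "independent V E (I j)" if "j \<in> {1..Suc (card ?C)}" for j
  proof (cases "j \<le> card ?C")
    case True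
    then have "f j \<in> ?C" using f that by (auto simp: bij_betw_def)
    then show ?thesis using ind True by (simp add: I_def)
  next
    case False
    then show ?thesis using ne by (auto simp: I_def independent_def)
  qed
  moreover have "\<exists>j\<in>{1..Suc (card ?C)}. e \<subseteq> I j" if e: "e \<in> ?C" for e
  proof -
    have "e \<in> f ` {1..card ?C}" using f e by (simp add: bij_betw_def)
    then obtain j where "j \<in> {1..card ?C}" "e = f j" by blast
    then show ?thesis by (intro bexI[of _ j]) (auto simp: I_def)
  qed
  ultimately show ?thesis unfolding covers_def by blast
qed

lemma theta_attained:
  assumes "kgraph k V E" "k \<ge> 1"
  shows "theta k V E \<ge> 1 \<and> (\<exists>I. covers k V E (theta k V E) I)"
    and "theta k V E \<le> Suc (card V choose k)"
proof -
  let ?P = "\<lambda>t. t \<ge> 1 \<and> (\<exists>I. covers k V E t I)"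
  have P: "?P (Suc (card (kcomplement k V E)))"
    using covers_exists[OF assms] by simp
  show "theta k V E \<ge> 1 \<and> (\<exists>I. covers k V E (theta k V E) I)"
    unfolding theta_def by (rule LeastI[of ?P, OF P])
  have "theta k V E \<le> Suc (card (kcomplement k V E))"
    unfolding theta_def by (rule Least_le[of ?P, OF P])
  also have "card (kcomplement k V E) \<le> card (nsets V k)"
    using assms by (intro card_mono) (auto simp: kgraph_def kcomplement_def finite_imp_finite_nsets)
  finally show "theta k V E \<le> Suc (card V choose k)"
    by simp
qed

lemma theta_max_attained:
  assumes "n \<ge> 1" "k \<ge> 1"
  shows "finite (theta_values n d k)" and "theta_max n d k \<in> theta_values n d k"
proof -
  have "theta_values n d k \<subseteq> {..Suc (n choose k)}"
    using theta_attained(2) assms by (fastforce simp: theta_values_def)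
  then show fin: "finite (theta_values n d k)"
    by (rule finite_subset) simp
  have "max_degree {..<n} {} \<le> d"
    using assms by (simp add: max_degree_def lessThan_empty_iff)
  then have "theta k {..<n} {} \<in> theta_values n d k"
    unfolding theta_values_def by (intro CollectI exI[of _ "{..<n}"] exI[of _ "{}"]) (auto simp: kgraph_def)
  then show "theta_max n d k \<in> theta_values n d k"
    unfolding theta_max_def using fin Max_in by blast
qed

end

theory Submission
  imports Defs "HOL-Combinatorics.Permutations"
begin

text \<open>
  Upper bound. Choose single vertices with probability of order \<open>\<sigma> = 1 / sqrt d\<close>. A random set of this
  density contains a fixed non-edge \<open>e\<close> with probability of order \<open>\<sigma>\<close> to the power \<open>k\<close>, and given this,
  typically no edge meeting \<open>e\<close>, unless some \<open>k - 1\<close> vertices of \<open>e\<close> lie in more than \<open>sqrt d\<close> edges.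
  Such heavy sets are so few that they, and the non-edges containing two of them, can be chosen as
  whole clusters in addition, an \<open>m\<close>-element cluster with probability of order \<open>\<sigma>\<close> to the power \<open>m\<close>.
  After removing the vertices that complete a heavy cluster to an edge, and then all vertices of surviving
  edges, the set is independent and still contains \<open>e\<close> with probability of order \<open>\<sigma>\<close> to the power \<open>k\<close>.
  A greedy choice of such sets covers all non-edges.

  Lower bound. Disjoint complete \<open>k\<close>-graphs on \<open>b\<close> vertices each, with \<open>b\<close> of order \<open>d\<close> to the power
  \<open>1 / (k - 1)\<close>, force every independent set to be small, so there are few independent sets. On top of
  them, matchings between the blocks of a \<open>k\<close>-partition give many \<open>k\<close>-graphs of degree at most \<open>d\<close>. A
  \<open>k\<close>-graph is determined by any independence cover of its complement, which bounds the size of the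
  covers from below. For even \<open>k\<close>, replace each vertex of a 2-graph by \<open>k / 2\<close> vertices.
\<close>

subsection \<open>Random subsets with independent elements\<close>

text \<open>The product measure on subsets of \<open>S\<close>, given by its point masses, so that
  every probability below is a finite sum.\<close>

definition subset_weight :: "('c \<Rightarrow> real) \<Rightarrow> 'c set \<Rightarrow> 'c set \<Rightarrow> real" where
  "subset_weight q S D = (\<Prod>c\<in>D. q c) * (\<Prod>c\<in>S - D. 1 - q c)"

definition subset_prob :: "('c \<Rightarrow> real) \<Rightarrow> 'c set \<Rightarrow> ('c set \<Rightarrow> bool) \<Rightarrow> real" where
  "subset_prob q S P = (\<Sum>D | D \<subseteq> S \<and> P D. subset_weight q S D)"

lemma subset_weight_nonneg:
  assumes "\<And>c. c \<in> S \<Longrightarrow> 0 \<le> q c \<and> q c \<le> 1" "D \<subseteq> S"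
  shows "0 \<le> subset_weight q S D"
  unfolding subset_weight_def using assms
  by (intro mult_nonneg_nonneg prod_nonneg) auto

lemma subset_prob_cong:
  assumes "\<And>D. D \<subseteq> S \<Longrightarrow> P D \<longleftrightarrow> Q D"
  shows "subset_prob q S P = subset_prob q S Q"
  unfolding subset_prob_def using assms by (intro sum.cong) auto

lemma subset_prob_mono:
  assumes "finite S" "\<And>c. c \<in> S \<Longrightarrow> 0 \<le> q c \<and> q c \<le> 1"
    and "\<And>D. D \<subseteq> S \<Longrightarrow> P D \<Longrightarrow> Q D"
  shows "subset_prob q S P \<le> subset_prob q S Q"
  unfolding subset_prob_def using assms
  by (intro sum_mono2) (auto intro!: subset_weight_nonneg)

lemma subset_prob_nonneg:
  assumes "\<And>c. c \<in> S \<Longrightarrow> 0 \<le> q c \<and> q c \<le> 1"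
  shows "0 \<le> subset_prob q S P"
  unfolding subset_prob_def using assms by (intro sum_nonneg) (auto intro!: subset_weight_nonneg)

text \<open>Conditioning on whether \<open>c\<close> is chosen; this recursion drives the inductions
  on the ground set.\<close>

lemma subset_prob_insert:
  assumes "finite S" "c \<notin> S"
  shows "subset_prob q (insert c S) P =
    q c * subset_prob q S (\<lambda>D. P (insert c D)) + (1 - q c) * subset_prob q S P"
proof -
  let ?A = "{D. D \<subseteq> S \<and> P (insert c D)}" and ?B = "{D. D \<subseteq> S \<and> P D}"
  have fin: "finite ?A" "finite ?B"
    using assms by (auto intro: finite_subset[of _ "Pow S"])
  have eq: "{D. D \<subseteq> insert c S \<and> P D} = insert c ` ?A \<union> ?B"
  proof (intro equalityI subsetI)
    fix D assume D: "D \<in> {D. D \<subseteq> insert c S \<and> P D}"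
    show "D \<in> insert c ` ?A \<union> ?B"
    proof (cases "c \<in> D")
      case True
      then have "D = insert c (D - {c})" by auto
      moreover from this D have "D - {c} \<in> ?A" by auto
      ultimately show ?thesis by blast
    qed (use D in auto)
  qed auto
  have inj: "inj_on (insert c) ?A"
    using assms by (intro inj_onI) (auto simp: insert_ident)
  have w1: "subset_weight q (insert c S) (insert c D) = q c * subset_weight q S D" if "D \<subseteq> S" for D
  proof -
    have "finite D" "c \<notin> D" using that assms finite_subset by auto
    moreover have "insert c S - insert c D = S - D" using assms that by auto
    ultimately show ?thesis by (simp add: subset_weight_def)
  qed
  have w2: "subset_weight q (insert c S) D = (1 - q c) * subset_weight q S D" if "D \<subseteq> S" for D
  proof -
    have "insert c S - D = insert c (S - D)" using assms that by auto
    then show ?thesis using assms by (simp add: subset_weight_def)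
  qed
  have "subset_prob q (insert c S) P =
      (\<Sum>D\<in>insert c ` ?A. subset_weight q (insert c S) D) + (\<Sum>D\<in>?B. subset_weight q (insert c S) D)"
    unfolding subset_prob_def eq using fin assms by (intro sum.union_disjoint) auto
  also have "(\<Sum>D\<in>insert c ` ?A. subset_weight q (insert c S) D) = q c * (\<Sum>D\<in>?A. subset_weight q S D)"
    using w1 by (simp add: sum.reindex[OF inj] sum_distrib_left)
  also have "(\<Sum>D\<in>?B. subset_weight q (insert c S) D) = (1 - q c) * (\<Sum>D\<in>?B. subset_weight q S D)"
    using w2 by (simp add: sum_distrib_left)
  finally show ?thesis by (simp add: subset_prob_def)
qed

lemma subset_prob_True:
  assumes "finite S"
  shows "subset_prob q S (\<lambda>_. True) = 1"
  using assms
proof (induction S rule: finite_induct)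
  case empty
  have "{D::'a set. D = {}} = {{}}" by auto
  then show ?case by (simp add: subset_prob_def subset_weight_def)
qed (simp add: subset_prob_insert)

lemma subset_prob_le_1:
  assumes "finite S" "\<And>c. c \<in> S \<Longrightarrow> 0 \<le> q c \<and> q c \<le> 1"
  shows "subset_prob q S P \<le> 1"
  using subset_prob_mono[OF assms, where P = P and Q = "\<lambda>_. True"] by (simp add: subset_prob_True assms)

lemma subset_prob_not:
  assumes "finite S"
  shows "subset_prob q S (\<lambda>D. \<not> P D) = 1 - subset_prob q S P"
proof -
  have "subset_prob q S (\<lambda>_. True) = subset_prob q S P + subset_prob q S (\<lambda>D. \<not> P D)"
    unfolding subset_prob_def using assms
    by (subst sum.union_disjoint[symmetric]) (auto intro!: sum.cong intro: finite_subset[of _ "Pow S"])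
  then show ?thesis by (simp add: subset_prob_True assms)
qed

lemma subset_prob_Bex:
  assumes "finite S" "\<And>c. c \<in> S \<Longrightarrow> 0 \<le> q c \<and> q c \<le> 1" "finite J"
  shows "subset_prob q S (\<lambda>D. \<exists>i\<in>J. P i D) \<le> (\<Sum>i\<in>J. subset_prob q S (P i))"
  using assms(3)
proof (induction J rule: finite_induct)
  case empty
  then show ?case by (simp add: subset_prob_def)
next
  case (insert j J)
  let ?X = "{D. D \<subseteq> S \<and> P j D}" and ?Y = "{D. D \<subseteq> S \<and> (\<exists>i\<in>J. P i D)}"
  have fin: "finite ?X" "finite ?Y"
    using assms(1) by (auto intro: finite_subset[of _ "Pow S"])
  have "{D. D \<subseteq> S \<and> (\<exists>i\<in>insert j J. P i D)} = ?X \<union> ?Y" by auto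
  then have "subset_prob q S (\<lambda>D. \<exists>i\<in>insert j J. P i D)
      = sum (subset_weight q S) ?X + sum (subset_weight q S) ?Y - sum (subset_weight q S) (?X \<inter> ?Y)"
    using sum_Un[OF fin, of "subset_weight q S"] by (simp add: subset_prob_def)
  moreover have "0 \<le> sum (subset_weight q S) (?X \<inter> ?Y)"
    using assms(2) by (intro sum_nonneg) (auto intro!: subset_weight_nonneg)
  ultimately show ?case using insert by (simp add: subset_prob_def)
qed

text \<open>Forcing all of \<open>F\<close> to be chosen costs the product of its probabilities and
  leaves the choice within \<open>S\<close> independent. The other outcomes on \<open>F\<close> are
  dropped.\<close>

lemma subset_prob_superset:
  assumes "finite F" "finite S" "F \<inter> S = {}"
    and "\<And>c. c \<in> F \<union> S \<Longrightarrow> 0 \<le> q c \<and> q c \<le> 1"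
  shows "(\<Prod>c\<in>F. q c) * subset_prob q S (\<lambda>D. P (F \<union> D)) \<le> subset_prob q (F \<union> S) P"
  using assms(1,3,4)
proof (induction F arbitrary: P rule: finite_induct)
  case (insert c F)
  have q: "0 \<le> q c" "q c \<le> 1" using insert.prems by auto
  have "q c * ((\<Prod>c\<in>F. q c) * subset_prob q S (\<lambda>D. P (insert c (F \<union> D))))
      \<le> q c * subset_prob q (F \<union> S) (\<lambda>D. P (insert c D))"
    using insert q by (intro mult_left_mono insert.IH) auto
  also have "\<dots> \<le> subset_prob q (insert c (F \<union> S)) P"
    using insert q assms(2) by (subst subset_prob_insert) (auto intro!: mult_nonneg_nonneg subset_prob_nonneg)
  finally show ?case using insert by (simp add: mult_ac)
qed auto

text \<open>Independence of \<open>c\<close> from the rest: this peels off one set in the covering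
  bound below.\<close>

lemma subset_prob_element:
  assumes "finite S" "c \<in> S"
  shows "subset_prob q S (\<lambda>D. c \<in> D \<and> P (D - {c})) = q c * subset_prob q (S - {c}) P"
proof -
  have "subset_prob q S (\<lambda>D. c \<in> D \<and> P (D - {c}))
      = subset_prob q (insert c (S - {c})) (\<lambda>D. c \<in> D \<and> P (D - {c}))"
    using assms by (simp add: insert_absorb)
  also have "\<dots> = q c * subset_prob q (S - {c}) (\<lambda>D. P (insert c D - {c}))
     + (1 - q c) * subset_prob q (S - {c}) (\<lambda>D. c \<in> D \<and> P (D - {c}))"
    using assms by (subst subset_prob_insert) auto
  also have "subset_prob q (S - {c}) (\<lambda>D. P (insert c D - {c})) = subset_prob q (S - {c}) P"
  proof (rule subset_prob_cong)
    fix D assume "D \<subseteq> S - {c}"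
    then have "insert c D - {c} = D" by auto
    then show "P (insert c D - {c}) = P D" by simp
  qed
  also have "subset_prob q (S - {c}) (\<lambda>D. c \<in> D \<and> P (D - {c})) = subset_prob q (S - {c}) (\<lambda>_. False)"
    by (rule subset_prob_cong) auto
  also have "\<dots> = 0" by (simp add: subset_prob_def)
  finally show ?thesis by simp
qed

text \<open>Induction on \<open>card X\<close>: some chosen set \<open>C\<close> contains a fixed
  \<open>x \<in> X\<close>, and the rest \<open>X - C\<close> must be covered by other sets,
  independently of \<open>C\<close>. Grouped by the trace \<open>P = X \<inter> C\<close>, each
  group has total weight at most \<open>K * \<sigma> ^ card P\<close>, and there are at most
  \<open>2 ^ m\<close> traces.\<close>

lemma subset_prob_cover:
  fixes S :: "'a set set"
  assumes "finite S" "\<And>C. C \<in> S \<Longrightarrow> 0 \<le> q C \<and> q C \<le> 1"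
    and "0 \<le> \<sigma>" "0 \<le> K" "2 ^ m * K \<le> 1"
    and "\<And>P. P \<noteq> {} \<Longrightarrow> (\<Sum>C | C \<in> S \<and> P \<subseteq> C. q C) \<le> K * \<sigma> ^ card P"
    and "finite X" "card X \<le> m"
  shows "subset_prob q S (\<lambda>D. X \<subseteq> \<Union>D) \<le> (if X = {} then 1 else 2 ^ m * K) * \<sigma> ^ card X"
  using assms
proof (induction "card X" arbitrary: X S rule: less_induct)
  case less
  show ?case
  proof (cases "X = {}")
    case True
    then show ?thesis using subset_prob_le_1 less.prems(1,2) by auto
  next
    case False
    then obtain x where x: "x \<in> X" by blast
    let ?J = "{C \<in> S. x \<in> C}"
    have fJ: "finite ?J" using less.prems by auto
    have single: "subset_prob q S (\<lambda>D. C \<in> D \<and> X - C \<subseteq> \<Union>(D - {C})) \<le> q C * \<sigma> ^ (card X - card (X \<inter> C))"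
      if "C \<in> ?J" for C
    proof -
      have lt: "card (X - C) < card X"
        using x that less.prems by (intro psubset_card_mono) auto
      have spread: "(\<Sum>B | B \<in> S - {C} \<and> P \<subseteq> B. q B) \<le> K * \<sigma> ^ card P" if "P \<noteq> {}" for P
      proof -
        have "(\<Sum>B | B \<in> S - {C} \<and> P \<subseteq> B. q B) \<le> (\<Sum>B | B \<in> S \<and> P \<subseteq> B. q B)"
          using less.prems by (intro sum_mono2) auto
        then show ?thesis using less.prems(6)[OF that] by simp
      qed
      have "subset_prob q (S - {C}) (\<lambda>D. X - C \<subseteq> \<Union>D)
          \<le> (if X - C = {} then 1 else 2 ^ m * K) * \<sigma> ^ card (X - C)"
        using less.prems lt spread by (intro less.hyps) auto
      \<comment> \<open>\<open>2 ^ m * K \<le> 1\<close> absorbs the factor of the induction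
        hypothesis, so constants do not accumulate.\<close>
      also have "\<dots> \<le> 1 * \<sigma> ^ card (X - C)"
        using less.prems by (intro mult_right_mono) auto
      also have "card (X - C) = card X - card (X \<inter> C)"
        using less.prems by (simp add: card_Diff_subset_Int)
      finally show ?thesis
        using that less.prems by (subst subset_prob_element) (auto intro!: mult_left_mono)
    qed
    have "subset_prob q S (\<lambda>D. X \<subseteq> \<Union>D)
        \<le> subset_prob q S (\<lambda>D. \<exists>C\<in>?J. C \<in> D \<and> X - C \<subseteq> \<Union>(D - {C}))"
    proof (rule subset_prob_mono)
      fix D assume D: "D \<subseteq> S" "X \<subseteq> \<Union>D"
      then obtain C where "C \<in> D" "x \<in> C" using x by blast
      then show "\<exists>C\<in>?J. C \<in> D \<and> X - C \<subseteq> \<Union>(D - {C})" using D by (intro bexI[of _ C]) auto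
    qed (use less.prems in auto)
    also have "\<dots> \<le> (\<Sum>C\<in>?J. subset_prob q S (\<lambda>D. C \<in> D \<and> X - C \<subseteq> \<Union>(D - {C})))"
      using less.prems fJ by (intro subset_prob_Bex) auto
    also have "\<dots> \<le> (\<Sum>C\<in>?J. q C * \<sigma> ^ (card X - card (X \<inter> C)))"
      using single by (intro sum_mono) auto
    also have "\<dots> = (\<Sum>P\<in>Pow X - {{}}. \<Sum>C | C \<in> ?J \<and> X \<inter> C = P. q C * \<sigma> ^ (card X - card (X \<inter> C)))"
      using fJ less.prems x by (intro sum.group[symmetric]) auto
    also have "\<dots> \<le> (\<Sum>P\<in>Pow X - {{}}. K * \<sigma> ^ card X)"
    proof (rule sum_mono)
      fix P assume P: "P \<in> Pow X - {{}}"
      then have cP: "card P \<le> card X" using less.prems by (auto intro: card_mono)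
      have "(\<Sum>C | C \<in> ?J \<and> X \<inter> C = P. q C * \<sigma> ^ (card X - card (X \<inter> C)))
          = (\<Sum>C | C \<in> ?J \<and> X \<inter> C = P. q C) * \<sigma> ^ (card X - card P)"
        by (simp add: sum_distrib_right)
      also have "\<dots> \<le> (\<Sum>C | C \<in> S \<and> P \<subseteq> C. q C) * \<sigma> ^ (card X - card P)"
        using less.prems by (intro mult_right_mono sum_mono2) auto
      also have "\<dots> \<le> (K * \<sigma> ^ card P) * \<sigma> ^ (card X - card P)"
        using P less.prems by (intro mult_right_mono) auto
      also have "\<dots> = K * \<sigma> ^ card X"
        using cP by (simp add: power_add[symmetric])
      finally show "(\<Sum>C | C \<in> ?J \<and> X \<inter> C = P. q C * \<sigma> ^ (card X - card (X \<inter> C))) \<le> K * \<sigma> ^ card X" .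
    qed
    also have "\<dots> = real (card (Pow X - {{}})) * (K * \<sigma> ^ card X)" by simp
    also have "\<dots> \<le> 2 ^ m * (K * \<sigma> ^ card X)"
    proof (rule mult_right_mono)
      have "card (Pow X - {{}}) \<le> card (Pow X)" using less.prems by (intro card_mono) auto
      also have "\<dots> = 2 ^ card X" using less.prems by (simp add: card_Pow)
      also have "\<dots> \<le> 2 ^ m" using less.prems by (intro power_increasing) auto
      finally show "real (card (Pow X - {{}})) \<le> 2 ^ m"
        by (metis of_nat_le_iff of_nat_numeral of_nat_power)
    qed (use less.prems in auto)
    finally show ?thesis using False by simp
  qed
qed

text \<open>On average an outcome covers at least the fraction \<open>\<delta>\<close> of the
  elements still uncovered, so some single outcome does too. Each round thus leaves at most the
  fraction \<open>1 - \<delta>\<close>.\<close>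

lemma greedy_cover:
  fixes W :: "'w \<Rightarrow> real"
  assumes "finite \<Omega>" "\<And>w. w \<in> \<Omega> \<Longrightarrow> 0 \<le> W w" "sum W \<Omega> = 1" "\<delta> \<le> 1"
    and "\<And>u. u \<in> U \<Longrightarrow> \<delta> \<le> (\<Sum>w | w \<in> \<Omega> \<and> R w u. W w)"
    and "finite U"
  shows "\<exists>g. (\<forall>j\<in>{1..t}. g j \<in> \<Omega>) \<and>
    real (card {u \<in> U. \<forall>j\<in>{1..t::nat}. \<not> R (g j) u}) \<le> real (card U) * (1 - \<delta>) ^ t"
proof (induction t)
  case 0
  show ?case by simp
next
  case (Suc t)
  then obtain g where g: "\<forall>j\<in>{1..t}. g j \<in> \<Omega>"
    "real (card {u \<in> U. \<forall>j\<in>{1..t}. \<not> R (g j) u}) \<le> real (card U) * (1 - \<delta>) ^ t"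
    by blast
  define X where "X = {u \<in> U. \<forall>j\<in>{1..t}. \<not> R (g j) u}"
  have fX: "finite X" using assms by (simp add: X_def)
  have "\<exists>w\<in>\<Omega>. \<delta> * card X \<le> real (card {u \<in> X. R w u})"
  proof (rule ccontr)
    assume "\<not> ?thesis"
    then have lt: "real (card {u \<in> X. R w u}) < \<delta> * card X" if "w \<in> \<Omega>" for w using that by force
    have "\<delta> * card X \<le> (\<Sum>u\<in>X. \<Sum>w | w \<in> \<Omega> \<and> R w u. W w)"
      using sum_bounded_below[of X \<delta> "\<lambda>u. \<Sum>w | w \<in> \<Omega> \<and> R w u. W w"] assms(5)
      by (auto simp: X_def mult.commute)
    also have "\<dots> = (\<Sum>w\<in>\<Omega>. \<Sum>u | u \<in> X \<and> R w u. W w)"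
      using assms fX by (intro sum.swap_restrict) auto
    also have "\<dots> = (\<Sum>w\<in>\<Omega>. W w * real (card {u \<in> X. R w u}))"
      by (simp add: mult.commute)
    also have "\<dots> < (\<Sum>w\<in>\<Omega>. W w * (\<delta> * card X))"
    proof -
      \<comment> \<open>An outcome of positive weight exists because the weights sum to 1; it makes
        the inequality strict.\<close>
      obtain w where "w \<in> \<Omega>" "W w > 0"
        using assms(2,3) by (metis less_eq_real_def sum.neutral zero_neq_one)
      then have "\<exists>w\<in>\<Omega>. W w * real (card {u \<in> X. R w u}) < W w * (\<delta> * card X)"
        using lt by (intro bexI[of _ w]) auto
      then show ?thesis using assms(1,2) lt
        by (intro sum_strict_mono_ex1) (auto intro: mult_left_mono less_imp_le)
    qed
    also have "\<dots> = \<delta> * card X" using assms by (simp add: sum_distrib_right[symmetric])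
    finally show False by simp
  qed
  then obtain w where w: "w \<in> \<Omega>" "\<delta> * card X \<le> real (card {u \<in> X. R w u})" by blast
  let ?g = "g(Suc t := w)"
  have "{u \<in> U. \<forall>j\<in>{1..Suc t}. \<not> R (?g j) u} = X - {u \<in> X. R w u}"
    by (auto simp: X_def atLeastAtMostSuc_conv)
  then have "real (card {u \<in> U. \<forall>j\<in>{1..Suc t}. \<not> R (?g j) u}) = card X - real (card {u \<in> X. R w u})"
    using fX by (simp add: card_Diff_subset of_nat_diff card_mono)
  also have "\<dots> \<le> card X * (1 - \<delta>)" using w by (simp add: algebra_simps)
  also have "\<dots> \<le> (real (card U) * (1 - \<delta>) ^ t) * (1 - \<delta>)"
    using g assms(4) by (intro mult_right_mono) (auto simp: X_def)
  finally show ?case using g w by (intro exI[of _ ?g]) (auto simp: mult_ac)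
qed

subsection \<open>Independence covers and extremal values\<close>

lemma theta_le:
  assumes "covers k V E t I" "1 \<le> t"
  shows "theta k V E \<le> t"
  unfolding theta_def by (rule Least_le) (use assms in auto)

text \<open>Pad with empty sets, which are independent because \<open>{}\<close> is no edge.\<close>

lemma covers_mono:
  assumes "covers k V E t I" "t \<le> T" "{} \<notin> E"
  shows "\<exists>I. covers k V E T I"
proof -
  have "covers k V E T (\<lambda>j. if j \<le> t then I j else {})"
    unfolding covers_def
  proof (intro conjI ballI)
    fix j assume "j \<in> {1..T}"
    then show "independent V E (if j \<le> t then I j else {})"
      using assms by (cases "j \<le> t") (auto simp: covers_def independent_def)
  next
    fix e assume "e \<in> kcomplement k V E"
    then obtain j where "j \<in> {1..t}" "e \<subseteq> I j" using assms by (auto simp: covers_def)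
    then show "\<exists>j\<in>{1..T}. e \<subseteq> (if j \<le> t then I j else {})"
      using assms by (intro bexI[of _ j]) auto
  qed
  then show ?thesis by blast
qed

text \<open>Serves both relabelling, where \<open>\<phi> v\<close> is a singleton, and blow-up,
  where it is a block of copies of \<open>v\<close>. An independent set is pulled back to the
  vertices whose whole image it contains.\<close>

lemma theta_pullback:
  assumes G: "kgraph k V E" and G': "kgraph k' W E'" "1 \<le> k'"
    and \<phi>: "\<And>e. e \<in> nsets V k \<Longrightarrow> \<Union>(\<phi> ` e) \<in> nsets W k'"
      "\<And>e. e \<in> nsets V k \<Longrightarrow> \<Union>(\<phi> ` e) \<in> E' \<longleftrightarrow> e \<in> E"
  shows "theta k V E \<le> theta k' W E'"
proof -
  obtain I where t: "1 \<le> theta k' W E'" and I: "covers k' W E' (theta k' W E') I"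
    using theta_attained(1)[OF G'] by blast
  have "covers k V E (theta k' W E') (\<lambda>j. {v \<in> V. \<phi> v \<subseteq> I j})"
    unfolding covers_def
  proof (intro conjI ballI)
    fix j assume j: "j \<in> {1..theta k' W E'}"
    have "\<not> e \<subseteq> {v \<in> V. \<phi> v \<subseteq> I j}" if e: "e \<in> E" for e
    proof
      assume sub: "e \<subseteq> {v \<in> V. \<phi> v \<subseteq> I j}"
      have "e \<in> nsets V k" using e G by (auto simp: kgraph_def)
      then have "\<Union>(\<phi> ` e) \<in> E'" using \<phi> e by blast
      moreover have "\<Union>(\<phi> ` e) \<subseteq> I j" using sub by blast
      moreover have "independent W E' (I j)" using I j unfolding covers_def by blast
      ultimately show False unfolding independent_def by blast
    qed
    then show "independent V E {v \<in> V. \<phi> v \<subseteq> I j}" unfolding independent_def by blast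
  next
    fix e assume "e \<in> kcomplement k V E"
    then have e: "e \<in> nsets V k" "e \<notin> E" by (auto simp: kcomplement_def)
    then have "\<Union>(\<phi> ` e) \<in> kcomplement k' W E'" using \<phi> by (auto simp: kcomplement_def)
    then obtain j where "j \<in> {1..theta k' W E'}" "\<Union>(\<phi> ` e) \<subseteq> I j"
      using I unfolding covers_def by blast
    moreover have "e \<subseteq> V" using e by (auto simp: nsets_def)
    ultimately show "\<exists>j\<in>{1..theta k' W E'}. e \<subseteq> {v \<in> V. \<phi> v \<subseteq> I j}"
      by (intro bexI[of _ j]) auto
  qed
  then show ?thesis using t by (rule theta_le)
qed

lemma max_degree_le_iff:
  assumes "finite V" "V \<noteq> {}"
  shows "max_degree V E \<le> d \<longleftrightarrow> (\<forall>v\<in>V. card {e \<in> E. v \<in> e} \<le> d)"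
  using assms by (simp add: max_degree_def)

text \<open>Vertices are renamed injectively into \<open>{..<n}\<close>, where any additional
  vertices are isolated. Thus constructions may use any vertex type and fewer than \<open>n\<close>
  vertices.\<close>

lemma theta_max_ge:
  assumes G: "kgraph k V E" and c: "card V \<le> n" "1 \<le> n" and k: "1 \<le> k"
    and deg: "\<And>v. v \<in> V \<Longrightarrow> card {e \<in> E. v \<in> e} \<le> d"
  shows "theta k V E \<le> theta_max n d k"
proof -
  have finV: "finite V" and EV: "E \<subseteq> nsets V k" using G by (auto simp: kgraph_def)
  have finE: "finite E" using EV finite_imp_finite_nsets[OF finV] by (rule finite_subset)
  obtain f where "bij_betw f V {0..<card V}" using ex_bij_betw_finite_nat[OF finV] by blast
  then have f: "inj_on f V" "f ` V \<subseteq> {..<n}" using c by (auto simp: bij_betw_def)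
  have sub: "e \<subseteq> V" if "e \<in> nsets V k" for e using that by (auto simp: nsets_def)
  have ns: "f ` e \<in> nsets {..<n} k" if "e \<in> nsets V k" for e
  proof -
    have "card (f ` e) = card e"
      using sub[OF that] f by (meson card_image inj_on_subset)
    then show ?thesis using that f by (auto simp: nsets_def)
  qed
  let ?E = "(`) f ` E"
  have G': "kgraph k {..<n} ?E" using ns EV by (auto simp: kgraph_def)
  have "theta k V E \<le> theta k {..<n} ?E"
  proof (rule theta_pullback[OF G G' k, where \<phi> = "\<lambda>v. {f v}"])
    fix e assume e: "e \<in> nsets V k"
    have eq: "\<Union>((\<lambda>v. {f v}) ` e) = f ` e" by auto
    show "\<Union>((\<lambda>v. {f v}) ` e) \<in> nsets {..<n} k" using ns[OF e] eq by simp
    have "e' = e" if "e' \<in> E" "f ` e = f ` e'" for e'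
    proof -
      have "e' \<subseteq> V" using EV that(1) by (intro sub) auto
      from inj_on_image_eq_iff[OF f(1) sub[OF e] this] that(2) show ?thesis by simp
    qed
    then show "\<Union>((\<lambda>v. {f v}) ` e) \<in> ?E \<longleftrightarrow> e \<in> E" unfolding eq by blast
  qed
  also have "\<dots> \<le> theta_max n d k"
    unfolding theta_max_def
  proof (rule Max_ge)
    show "finite (theta_values n d k)" using c k by (intro theta_max_attained)
    have "card {e \<in> ?E. w \<in> e} \<le> d" for w
    proof (cases "w \<in> f ` V")
      case True
      then obtain v where v: "v \<in> V" "w = f v" by blast
      have "{e \<in> ?E. w \<in> e} \<subseteq> (`) f ` {e \<in> E. v \<in> e}"
      proof
        fix e' assume "e' \<in> {e \<in> ?E. w \<in> e}"
        then obtain e where e: "e \<in> E" "e' = f ` e" "f v \<in> f ` e" using v by auto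
        moreover have "e \<subseteq> V" using EV e(1) by (intro sub) auto
        ultimately have "v \<in> e" using inj_on_image_mem_iff[OF f(1) v(1)] by simp
        then show "e' \<in> (`) f ` {e \<in> E. v \<in> e}" using e by blast
      qed
      then have "card {e \<in> ?E. w \<in> e} \<le> card {e \<in> E. v \<in> e}"
        by (rule surj_card_le[rotated]) (use finE in auto)
      then show ?thesis using deg[OF v(1)] by simp
    next
      case False
      have "w \<notin> f ` e" if "e \<in> E" for e
        using False sub[of e] EV that by (meson image_mono subsetD)
      then have "{e \<in> ?E. w \<in> e} = {}" by auto
      then show ?thesis by (simp only: card.empty)
    qed
    then have "max_degree {..<n} ?E \<le> d"
      using c by (subst max_degree_le_iff) (auto simp: lessThan_empty_iff)
    then show "theta k {..<n} ?E \<in> theta_values n d k"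
      using G' unfolding theta_values_def by (intro CollectI exI[of _ "{..<n}"] exI[of _ ?E]) auto
  qed
  finally show ?thesis .
qed

lemma theta_max_witness:
  assumes "1 \<le> n" "1 \<le> k"
  shows "\<exists>(V :: nat set) E. kgraph k V E \<and> card V = n \<and> theta k V E = theta_max n d k \<and>
    (\<forall>v\<in>V. card {e \<in> E. v \<in> e} \<le> d)"
proof -
  obtain V :: "nat set" and E where VE: "kgraph k V E" "card V = n" "theta k V E = theta_max n d k"
    "max_degree V E \<le> d"
    using theta_max_attained(2)[OF assms, of d] by (auto simp: theta_values_def)
  then have "finite V" "V \<noteq> {}" using assms by (auto simp: kgraph_def)
  then have "\<forall>v\<in>V. card {e \<in> E. v \<in> e} \<le> d" using VE(4) max_degree_le_iff by blast
  then show ?thesis using VE by blast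
qed

text \<open>Replacing each vertex by \<open>K\<close> copies multiplies the uniformity by
  \<open>K\<close> without raising degrees. This carries bounds for 2-graphs to even
  uniformity.\<close>

lemma theta_max_blowup:
  assumes "1 \<le> K" "1 \<le> n" "1 \<le> k" "K * n \<le> N"
  shows "theta_max n d k \<le> theta_max N d (K * k)"
proof -
  obtain V :: "nat set" and E where G: "kgraph k V E" and VE: "card V = n" "theta k V E = theta_max n d k"
    and deg: "\<forall>v\<in>V. card {e \<in> E. v \<in> e} \<le> d"
    using theta_max_witness[OF assms(2,3), of d] by blast
  have finV: "finite V" and EV: "E \<subseteq> nsets V k" using G by (auto simp: kgraph_def)
  have finE: "finite E" using EV finite_imp_finite_nsets[OF finV] by (rule finite_subset)
  let ?W = "V \<times> {..<K}"
  let ?b = "\<lambda>e. e \<times> {..<K}"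
  have ns: "?b e \<in> nsets ?W (K * k)" if "e \<in> nsets V k" for e
    using that by (auto simp: nsets_def card_cartesian_product)
  have inj: "?b e = ?b e' \<longleftrightarrow> e = e'" for e e' :: "nat set"
  proof -
    have "{..<K} \<noteq> {}" using assms(1) by (simp add: lessThan_empty_iff)
    then have "fst ` ?b g = g" for g :: "nat set" by (simp only: fst_image_times if_False)
    then show ?thesis by metis
  qed
  have G': "kgraph (K * k) ?W (?b ` E)" using ns EV finV by (auto simp: kgraph_def)
  have "theta k V E \<le> theta (K * k) ?W (?b ` E)"
  proof (rule theta_pullback[OF G G', where \<phi> = "\<lambda>v. {v} \<times> {..<K}"])
    fix e assume e: "e \<in> nsets V k"
    have eq: "\<Union>((\<lambda>v. {v} \<times> {..<K}) ` e) = ?b e" by auto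
    show "\<Union>((\<lambda>v. {v} \<times> {..<K}) ` e) \<in> nsets ?W (K * k)" using ns[OF e] eq by simp
    show "\<Union>((\<lambda>v. {v} \<times> {..<K}) ` e) \<in> ?b ` E \<longleftrightarrow> e \<in> E"
      unfolding eq by (simp add: image_iff inj)
  qed (use assms in simp)
  also have "\<dots> \<le> theta_max N d (K * k)"
  proof (rule theta_max_ge[OF G'])
    show "card ?W \<le> N" using assms VE by (simp add: card_cartesian_product mult.commute)
    have "1 * 1 \<le> K * n" using assms by (intro mult_mono) auto
    then show "1 \<le> N" using assms(4) by linarith
    show "1 \<le> K * k" using assms by simp
    fix w assume "w \<in> ?W"
    then obtain v i where v: "v \<in> V" "w = (v, i)" by auto
    have "{e \<in> ?b ` E. w \<in> e} \<subseteq> ?b ` {e \<in> E. v \<in> e}" using v by auto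
    then have "card {e \<in> ?b ` E. w \<in> e} \<le> card {e \<in> E. v \<in> e}"
      by (rule surj_card_le[rotated]) (use finE in auto)
    then show "card {e \<in> ?b ` E. w \<in> e} \<le> d" using deg v(1) by (meson order_trans)
  qed
  finally show ?thesis using VE by simp
qed

text \<open>A set of size at most \<open>Suc m\<close> is one of size at most \<open>m\<close> with
  at most one element added; the \<open>option\<close> value says which, if any.\<close>

lemma card_subsets_card_le:
  assumes "finite B"
  shows "finite {S. S \<subseteq> B \<and> card S \<le> m} \<and> card {S. S \<subseteq> B \<and> card S \<le> m} \<le> (card B + 1) ^ m"
proof (induction m)
  case 0
  have "{S. S \<subseteq> B \<and> card S \<le> 0} = {{}}" using assms finite_subset by fastforce
  then show ?case by simp
next
  case (Suc m)
  let ?S = "\<lambda>m. {S. S \<subseteq> B \<and> card S \<le> m}"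
  let ?g = "\<lambda>(y, S). case y of None \<Rightarrow> S | Some x \<Rightarrow> insert x S"
  let ?O = "insert None (Some ` B)"
  have "?S (Suc m) \<subseteq> ?g ` (?O \<times> ?S m)"
  proof
    fix S assume S: "S \<in> ?S (Suc m)"
    show "S \<in> ?g ` (?O \<times> ?S m)"
    proof (cases "card S \<le> m")
      case True
      then show ?thesis using S by (intro image_eqI[of _ _ "(None, S)"]) auto
    next
      case False
      then obtain x where x: "x \<in> S" by fastforce
      have "finite S" using S assms finite_subset by auto
      then have "S - {x} \<in> ?S m" using S x by auto
      then show ?thesis using S x by (intro image_eqI[of _ _ "(Some x, S - {x})"]) auto
    qed
  qed
  moreover have fin: "finite (?O \<times> ?S m)" using Suc assms by auto
  ultimately have "card (?S (Suc m)) \<le> card (?O \<times> ?S m)"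
    by (meson card_image_le card_mono finite_imageI order_trans)
  also have "\<dots> = card ?O * card (?S m)" by (rule card_cartesian_product)
  also have "card ?O = card B + 1" using assms by (simp add: card_image)
  also have "(card B + 1) * card (?S m) \<le> (card B + 1) * (card B + 1) ^ m"
    using Suc by (intro mult_left_mono) auto
  finally show ?case using assms by (auto simp: power_Suc)
qed

subsection \<open>The upper bound\<close>

lemma subset_prob_disj:
  assumes "finite S" "\<And>c. c \<in> S \<Longrightarrow> 0 \<le> q c \<and> q c \<le> 1"
  shows "subset_prob q S (\<lambda>D. P D \<or> Q D) \<le> subset_prob q S P + subset_prob q S Q"
proof -
  have "subset_prob q S (\<lambda>D. P D \<or> Q D)
      = subset_prob q S (\<lambda>D. \<exists>b\<in>{True, False}. (if b then P else Q) D)"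
    by (rule subset_prob_cong) auto
  also have "\<dots> \<le> (\<Sum>b\<in>{True, False}. subset_prob q S (if b then P else Q))"
    by (rule subset_prob_Bex) (use assms in auto)
  finally show ?thesis by simp
qed

lemma sum_Un_le:
  fixes f :: "'b \<Rightarrow> real"
  assumes "finite A" "finite B" "\<And>x. x \<in> A \<inter> B \<Longrightarrow> 0 \<le> f x"
  shows "sum f (A \<union> B) \<le> sum f A + sum f B"
proof -
  have "0 \<le> sum f (A \<inter> B)" using assms(3) by (rule sum_nonneg)
  then show ?thesis using sum_Un[OF assms(1,2), of f] by simp
qed

text \<open>By inclusion-exclusion the two sets share \<open>k - 2\<close> elements, hence at least
  one as \<open>3 \<le> k\<close>.\<close>

lemma facets_union_inter:
  assumes "finite e" "card e = k" "3 \<le> k" "P \<subseteq> e" "B \<subseteq> e" "card P = k - 1" "card B = k - 1" "P \<noteq> B"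
  shows "P \<union> B = e" "P \<inter> B \<noteq> {}"
proof -
  have fin: "finite P" "finite B" using assms finite_subset by auto
  have "\<not> B \<subseteq> P" using assms(6,7,8) card_subset_eq[OF fin(1), of B] by auto
  then have "card P < card (P \<union> B)" using fin by (intro psubset_card_mono) auto
  moreover have "card (P \<union> B) \<le> card e" using assms by (intro card_mono) auto
  ultimately have c: "card (P \<union> B) = k" using assms by auto
  show "P \<union> B = e" using assms c by (intro card_subset_eq) auto
  have "card P + card B = card (P \<union> B) + card (P \<inter> B)" using fin by (rule card_Un_Int)
  then have "card (P \<inter> B) \<noteq> 0" using c assms by auto
  then show "P \<inter> B \<noteq> {}" by force
qed

lemma card_UN_le_mult:
  assumes "finite I" "\<And>i. i \<in> I \<Longrightarrow> real (card (A i)) \<le> c"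
  shows "real (card (\<Union>i\<in>I. A i)) \<le> real (card I) * c"
proof -
  have "real (card (\<Union>i\<in>I. A i)) \<le> real (\<Sum>i\<in>I. card (A i))"
    using card_UN_le[OF assms(1)] by (simp only: of_nat_le_iff)
  also have "\<dots> \<le> real (card I) * c"
    using sum_bounded_above[of I "\<lambda>i. real (card (A i))" c] assms(2) by simp
  finally show ?thesis .
qed

locale sparse_kgraph =
  fixes k :: nat and V :: "'a set" and E :: "'a set set" and d :: nat
  assumes k: "3 \<le> k" and d: "1 \<le> d" and finV: "finite V" and EV: "E \<subseteq> nsets V k"
    and deg: "\<And>v. v \<in> V \<Longrightarrow> card {e \<in> E. v \<in> e} \<le> d"
begin

text \<open>In a random vertex set of density \<open>d\<close> to the power \<open>-1/2\<close>, a set of at most \<open>k - 2\<close>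
  vertices has a bounded expected number of extensions to an edge. Only \<open>(k-1)\<close>-sets can have more,
  namely the heavy ones, and each vertex lies in few of them.\<close>

definition heavy :: "'a set set" where
  "heavy = {A \<in> nsets V (k - 1). sqrt d < card {e \<in> E. A \<subseteq> e}}"

definition bi_heavy :: "'a set set" where
  "bi_heavy = {e \<in> nsets V k - E. \<exists>A\<in>heavy. \<exists>B\<in>heavy. A \<noteq> B \<and> A \<subseteq> e \<and> B \<subseteq> e}"

text \<open>A non-edge with one heavy subset splits into that subset and a single vertex. With two
  heavy subsets no such splitting would protect both, so the non-edge is chosen as a whole.\<close>

definition clusters :: "'a set set" where
  "clusters = (\<lambda>v. {v}) ` V \<union> heavy \<union> bi_heavy"

definition \<sigma> :: real where "\<sigma> = 1 / sqrt d"

lemma \<sigma>: "0 < \<sigma>" "\<sigma> \<le> 1" "sqrt d * \<sigma> = 1" "real d * \<sigma>\<^sup>2 = 1"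
  using d by (auto simp: \<sigma>_def power_divide)

lemma finite_families: "finite E" "finite heavy" "finite bi_heavy" "finite clusters"
proof -
  have "finite (nsets V j)" for j using finV by (rule finite_imp_finite_nsets)
  then show "finite E" "finite heavy" "finite bi_heavy" "finite clusters"
    using finite_subset[OF EV] finV by (auto simp: heavy_def bi_heavy_def clusters_def)
qed

lemma edgeD: "e \<in> E \<Longrightarrow> e \<subseteq> V \<and> finite e \<and> card e = k"
  using EV by (auto simp: nsets_def)

lemma heavyD: "A \<in> heavy \<Longrightarrow> A \<subseteq> V \<and> finite A \<and> card A = k - 1"
  by (auto simp: heavy_def nsets_def)

lemma bi_heavyD: "e \<in> bi_heavy \<Longrightarrow> e \<subseteq> V \<and> finite e \<and> card e = k"
  by (auto simp: bi_heavy_def nsets_def)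

section \<open>Degrees and spread of the clusters\<close>

text \<open>Double count the pairs of a heavy set \<open>A\<close> through \<open>v\<close> and an
  edge containing \<open>A\<close>. Each \<open>A\<close> lies in more than \<open>sqrt d\<close>
  edges, while each of the at most \<open>d\<close> edges at \<open>v\<close> has only
  \<open>k\<close> subsets of size \<open>k - 1\<close>.\<close>

lemma heavy_degree: "real (card {A \<in> heavy. v \<in> A}) \<le> real k * sqrt d"
proof (cases "v \<in> V")
  case False
  then have "{A \<in> heavy. v \<in> A} = {}" using heavyD by auto
  then have "card {A \<in> heavy. v \<in> A} = 0" by (simp only: card.empty)
  then show ?thesis by simp
next
  case True
  let ?H = "{A \<in> heavy. v \<in> A}" and ?E = "{e \<in> E. v \<in> e}"
  have fin: "finite ?H" "finite ?E" using finite_families by auto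
  have "sqrt d * card ?H \<le> (\<Sum>A\<in>?H. real (card {e \<in> E. A \<subseteq> e}))"
    using sum_bounded_below[of ?H "sqrt d" "\<lambda>A. real (card {e \<in> E. A \<subseteq> e})"]
    by (auto simp: heavy_def mult.commute)
  also have "\<dots> = (\<Sum>A\<in>?H. \<Sum>e | e \<in> ?E \<and> A \<subseteq> e. 1)"
  proof (rule sum.cong)
    fix A assume "A \<in> ?H"
    then have "{e. e \<in> ?E \<and> A \<subseteq> e} = {e \<in> E. A \<subseteq> e}" by auto
    then show "real (card {e \<in> E. A \<subseteq> e}) = (\<Sum>e | e \<in> ?E \<and> A \<subseteq> e. 1)" by simp
  qed simp
  also have "\<dots> = (\<Sum>e\<in>?E. \<Sum>A | A \<in> ?H \<and> A \<subseteq> e. 1)"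
    using fin by (rule sum.swap_restrict)
  also have "\<dots> \<le> (\<Sum>e\<in>?E. real k)"
  proof (rule sum_mono)
    fix e assume "e \<in> ?E"
    then have e: "finite e" "card e = k" using edgeD by auto
    have "card {A. A \<in> ?H \<and> A \<subseteq> e} \<le> card (nsets e (k - 1))"
      using e heavyD by (intro card_mono finite_imp_finite_nsets) (auto simp: nsets_def)
    also have "\<dots> = k"
      using e k binomial_symmetric[of "k - 1" k] by simp
    finally show "(\<Sum>A | A \<in> ?H \<and> A \<subseteq> e. 1) \<le> real k" by simp
  qed
  also have "\<dots> \<le> real d * real k" using deg[OF True] by (simp add: mult_right_mono)
  also have "\<dots> = sqrt d * (sqrt d * k)" by simp
  finally have "sqrt d * card ?H \<le> sqrt d * (sqrt d * k)" .
  then show ?thesis using d by (simp add: mult.commute)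
qed

text \<open>The spread hypothesis of \<open>subset_prob_cover\<close> for heavy sets. At most one
  heavy set contains a given \<open>P\<close> of size \<open>k - 1\<close>; for smaller
  \<open>P\<close>, \<open>heavy_degree\<close> at one vertex costs \<open>sqrt d\<close>, which
  cancels one of the \<open>k - 1\<close> factors \<open>\<sigma>\<close>.\<close>

lemma heavy_spread:
  assumes "P \<noteq> {}"
  shows "real (card {A \<in> heavy. P \<subseteq> A}) * \<sigma> ^ (k - 1) \<le> k * \<sigma> ^ card P"
proof (cases "{A \<in> heavy. P \<subseteq> A} = {}")
  case True
  then have "card {A \<in> heavy. P \<subseteq> A} = 0" by (simp only: card.empty)
  then show ?thesis using \<sigma> by simp
next
  case False
  then obtain A where A: "A \<in> heavy" "P \<subseteq> A" by blast
  then have P: "finite P" "card P \<le> k - 1"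
    using heavyD[OF A(1)] finite_subset[of P A] card_mono[of A P] by auto
  show ?thesis
  proof (cases "card P = k - 1")
    case True
    have "A = P" if "A \<in> heavy" "P \<subseteq> A" for A
      using card_subset_eq[of A P] heavyD[OF that(1)] that(2) True by auto
    then have "{A \<in> heavy. P \<subseteq> A} \<subseteq> {P}" by blast
    from card_mono[OF _ this] have "real (card {A \<in> heavy. P \<subseteq> A}) \<le> k" using k by simp
    then show ?thesis using \<sigma> by (simp add: True mult_right_mono)
  next
    case False
    obtain v where v: "v \<in> P" using assms by blast
    have "real (card {A \<in> heavy. P \<subseteq> A}) \<le> real (card {A \<in> heavy. v \<in> A})"
      using finite_families v by (intro of_nat_mono card_mono) auto
    also have "\<dots> \<le> k * sqrt d" by (rule heavy_degree)
    finally have "real (card {A \<in> heavy. P \<subseteq> A}) * \<sigma> ^ (k - 1) \<le> (k * sqrt d) * \<sigma> ^ (k - 1)"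
      using \<sigma> by (intro mult_right_mono) auto
    also have "\<dots> = k * (sqrt d * \<sigma>) * \<sigma> ^ (k - 2)"
    proof -
      have "\<sigma> ^ (k - 1) = \<sigma> * \<sigma> ^ (k - 2)"
        using k by (simp add: power_Suc[symmetric] Suc_diff_Suc numeral_2_eq_2)
      then show ?thesis by (simp only: mult_ac)
    qed
    also have "\<dots> \<le> k * \<sigma> ^ card P"
      using \<sigma> False P by (auto intro!: mult_left_mono power_decreasing)
    finally show ?thesis .
  qed
qed

text \<open>Of two heavy subsets of \<open>e\<close> at least one differs from \<open>P\<close>, and
  \<open>facets_union_inter\<close> applies to it.\<close>

lemma bi_heavy_split:
  assumes "e \<in> bi_heavy" "P \<subseteq> e" "card P = k - 1"
  shows "\<exists>B\<in>heavy. P \<union> B = e \<and> P \<inter> B \<noteq> {}"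
proof -
  obtain A B where AB: "A \<in> heavy" "B \<in> heavy" "A \<noteq> B" "A \<subseteq> e" "B \<subseteq> e"
    using assms by (auto simp: bi_heavy_def)
  have *: "P \<union> C = e \<and> P \<inter> C \<noteq> {}" if "C \<in> heavy" "C \<subseteq> e" "P \<noteq> C" for C
    using facets_union_inter[of e k P C] bi_heavyD[OF assms(1)] heavyD[OF that(1)] assms that k by auto
  show ?thesis using *[of A] *[of B] AB by metis
qed

text \<open>A set in \<open>bi_heavy\<close> is recovered from intersecting heavy sets, so
  \<open>heavy_degree\<close> bounds the choices. For \<open>card P = k - 1\<close> one heavy set
  meeting \<open>P\<close> suffices and costs \<open>sqrt d\<close>; for smaller \<open>P\<close>
  two are used, the first through a vertex of \<open>P\<close> and the second meeting the first, at
  a cost of \<open>d\<close>. Each \<open>sqrt d\<close> cancels one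
  \<open>\<sigma>\<close>.\<close>

lemma bi_heavy_spread:
  assumes "P \<noteq> {}"
  shows "real (card {e \<in> bi_heavy. P \<subseteq> e}) * \<sigma> ^ k \<le> real k ^ 3 * \<sigma> ^ card P"
proof (cases "{e \<in> bi_heavy. P \<subseteq> e} = {}")
  case True
  then have "card {e \<in> bi_heavy. P \<subseteq> e} = 0" by (simp only: card.empty)
  then show ?thesis using \<sigma> by simp
next
  case False
  then obtain e0 where e0: "e0 \<in> bi_heavy" "P \<subseteq> e0" by blast
  then have P: "finite P" "card P \<le> k"
    using bi_heavyD[OF e0(1)] finite_subset[of P e0] card_mono[of e0 P] by auto
  have k1: "1 \<le> real k" using k by simp
  consider "card P = k" | "card P = k - 1" | "card P \<le> k - 2" using P by linarith
  then show ?thesis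
  proof cases
    case 1
    have "e = P" if "e \<in> bi_heavy" "P \<subseteq> e" for e
      using card_subset_eq[of e P] bi_heavyD[OF that(1)] that(2) 1 by auto
    then have "{e \<in> bi_heavy. P \<subseteq> e} \<subseteq> {P}" by blast
    from card_mono[OF _ this] have "real (card {e \<in> bi_heavy. P \<subseteq> e}) \<le> 1" by simp
    also have "\<dots> \<le> real k ^ 3" using k1 by (rule one_le_power)
    finally show ?thesis using \<sigma> by (simp add: 1 mult_right_mono)
  next
    case 2
    let ?U = "\<Union>u\<in>P. {B \<in> heavy. u \<in> B}"
    have "{e \<in> bi_heavy. P \<subseteq> e} \<subseteq> (\<lambda>B. P \<union> B) ` ?U"
    proof
      fix e assume "e \<in> {e \<in> bi_heavy. P \<subseteq> e}"
      then have "e \<in> bi_heavy" "P \<subseteq> e" by auto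
      from bi_heavy_split[OF this 2]
      obtain B where B: "B \<in> heavy" "P \<union> B = e" "P \<inter> B \<noteq> {}" by blast
      then have "B \<in> ?U" by blast
      then show "e \<in> (\<lambda>B. P \<union> B) ` ?U" using B by blast
    qed
    moreover have fU: "finite ?U" using P finite_families by auto
    ultimately have "card {e \<in> bi_heavy. P \<subseteq> e} \<le> card ?U"
      by (meson card_image_le card_mono finite_imageI order_trans)
    then have "real (card {e \<in> bi_heavy. P \<subseteq> e}) \<le> real (card ?U)" by simp
    also have "\<dots> \<le> card P * (k * sqrt d)"
      using P heavy_degree by (intro card_UN_le_mult) auto
    also have "\<dots> \<le> k * (k * sqrt d)" using P by (intro mult_right_mono) auto
    also have "\<dots> \<le> k * (k * (k * sqrt d))" using k1 d by (intro mult_left_mono) auto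
    also have "\<dots> = real k ^ 3 * sqrt d" by (simp add: power3_eq_cube)
    finally have "real (card {e \<in> bi_heavy. P \<subseteq> e}) * \<sigma> ^ k \<le> (real k ^ 3 * sqrt d) * \<sigma> ^ k"
      using \<sigma> by (intro mult_right_mono) auto
    also have "\<dots> = real k ^ 3 * (sqrt d * \<sigma>) * \<sigma> ^ (k - 1)"
    proof -
      have "\<sigma> ^ k = \<sigma> * \<sigma> ^ (k - 1)" using k by (simp add: power_Suc[symmetric])
      then show ?thesis by (simp only: mult_ac)
    qed
    finally show ?thesis using \<sigma> 2 by simp
  next
    case 3
    obtain v where v: "v \<in> P" using assms by blast
    let ?S = "\<lambda>A. \<Union>u\<in>A. {B \<in> heavy. u \<in> B}"
    let ?X = "SIGMA A : {A \<in> heavy. v \<in> A}. ?S A"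
    have "{e \<in> bi_heavy. P \<subseteq> e} \<subseteq> (\<lambda>(A, B). A \<union> B) ` ?X"
    proof
      fix e assume e: "e \<in> {e \<in> bi_heavy. P \<subseteq> e}"
      then obtain A B where AB: "A \<in> heavy" "B \<in> heavy" "A \<noteq> B" "A \<subseteq> e" "B \<subseteq> e"
        by (auto simp: bi_heavy_def)
      have *: "A \<union> B = e" "A \<inter> B \<noteq> {}"
        using facets_union_inter[of e k A B] bi_heavyD e heavyD AB k by auto
      \<comment> \<open>Order the two heavy sets so that the first contains
        \<open>v\<close>.\<close>
      then consider "v \<in> A" | "v \<in> B" using e v by blast
      then show "e \<in> (\<lambda>(A, B). A \<union> B) ` ?X"
      proof cases
        case 1 then show ?thesis using AB * by (intro image_eqI[of _ _ "(A, B)"]) auto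
      next
        case 2 then show ?thesis using AB * by (intro image_eqI[of _ _ "(B, A)"]) auto
      qed
    qed
    moreover have fX: "finite ?X"
      using finite_families heavyD by (intro finite_SigmaI) auto
    ultimately have "card {e \<in> bi_heavy. P \<subseteq> e} \<le> card ?X"
      by (meson card_image_le card_mono finite_imageI order_trans)
    also have "card ?X = (\<Sum>A | A \<in> heavy \<and> v \<in> A. card (?S A))"
      using finite_families heavyD by (subst card_SigmaI) auto
    finally have "real (card {e \<in> bi_heavy. P \<subseteq> e}) \<le> (\<Sum>A | A \<in> heavy \<and> v \<in> A. real (card (?S A)))"
      by (simp only: of_nat_sum[symmetric] of_nat_le_iff)
    also have "\<dots> \<le> real (card {A \<in> heavy. v \<in> A}) * (k * (k * sqrt d))"
    proof (rule sum_bounded_above)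
      fix A assume A: "A \<in> {A \<in> heavy. v \<in> A}"
      have "real (card (?S A)) \<le> card A * (k * sqrt d)"
        using A heavyD heavy_degree by (intro card_UN_le_mult) auto
      also have "\<dots> \<le> k * (k * sqrt d)" using A heavyD[of A] by (intro mult_right_mono) auto
      finally show "real (card (?S A)) \<le> k * (k * sqrt d)" .
    qed
    also have "\<dots> \<le> (k * sqrt d) * (k * (k * sqrt d))"
      using heavy_degree by (intro mult_right_mono) auto
    also have "\<dots> = real k ^ 3 * d" by (simp add: power3_eq_cube algebra_simps)
    finally have "real (card {e \<in> bi_heavy. P \<subseteq> e}) * \<sigma> ^ k \<le> (real k ^ 3 * real d) * \<sigma> ^ k"
      using \<sigma> by (intro mult_right_mono) auto
    also have "\<dots> = real k ^ 3 * (real d * \<sigma>\<^sup>2) * \<sigma> ^ (k - 2)"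
    proof -
      have "2 + (k - 2) = k" using k by simp
      then have "\<sigma> ^ k = \<sigma>\<^sup>2 * \<sigma> ^ (k - 2)"
        using power_add[of \<sigma> 2 "k - 2"] by (simp only:)
      then show ?thesis by (simp only: mult_ac)
    qed
    also have "\<dots> \<le> real k ^ 3 * \<sigma> ^ card P"
      using \<sigma> 3 by (auto intro!: mult_left_mono power_decreasing)
    finally show ?thesis .
  qed
qed

lemma cluster_spread:
  assumes "0 \<le> \<epsilon>" "P \<noteq> {}"
  shows "(\<Sum>C | C \<in> clusters \<and> P \<subseteq> C. \<epsilon> * \<sigma> ^ card C) \<le> (1 + real k + real k ^ 3) * \<epsilon> * \<sigma> ^ card P"
proof -
  let ?f = "\<lambda>C::'a set. \<epsilon> * \<sigma> ^ card C"
  let ?A = "{C \<in> (\<lambda>v. {v}) ` V. P \<subseteq> C}" and ?B = "{C \<in> heavy. P \<subseteq> C}" and ?C = "{C \<in> bi_heavy. P \<subseteq> C}"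
  have fin: "finite ?A" "finite ?B" "finite ?C" using finite_families finV by auto
  have f: "0 \<le> ?f C" for C using assms \<sigma> by simp
  have "{C. C \<in> clusters \<and> P \<subseteq> C} = (?A \<union> ?B) \<union> ?C" by (auto simp: clusters_def)
  then have "sum ?f {C. C \<in> clusters \<and> P \<subseteq> C} \<le> sum ?f (?A \<union> ?B) + sum ?f ?C"
    using fin f by (simp only:) (rule sum_Un_le, auto)
  also have "sum ?f (?A \<union> ?B) \<le> sum ?f ?A + sum ?f ?B"
    by (rule sum_Un_le) (use fin f in auto)
  \<comment> \<open>A nonempty \<open>P\<close> lies in a singleton only if it equals that
    singleton.\<close>
  also have "sum ?f ?A \<le> sum ?f {P}"
    using assms f by (intro sum_mono2) auto
  also have "sum ?f ?B = (\<Sum>C\<in>?B. \<epsilon> * \<sigma> ^ (k - 1))" using heavyD by (intro sum.cong) auto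
  also have "\<dots> = \<epsilon> * (card ?B * \<sigma> ^ (k - 1))" by simp
  also have "\<dots> \<le> \<epsilon> * (k * \<sigma> ^ card P)"
    using heavy_spread[OF assms(2)] assms(1) by (rule mult_left_mono)
  also have "sum ?f ?C = (\<Sum>C\<in>?C. \<epsilon> * \<sigma> ^ k)" using bi_heavyD by (intro sum.cong) auto
  also have "\<dots> = \<epsilon> * (card ?C * \<sigma> ^ k)" by simp
  also have "\<dots> \<le> \<epsilon> * (real k ^ 3 * \<sigma> ^ card P)"
    using bi_heavy_spread[OF assms(2)] assms(1) by (rule mult_left_mono)
  finally show ?thesis by (simp add: algebra_simps)
qed

section \<open>Survival of a fixed non-edge\<close>

text \<open>The sizes add up to \<open>k\<close>, so that all of \<open>F\<close> is chosen with
  probability \<open>\<epsilon> ^ card F * \<sigma> ^ k\<close>. Keeping each heavy subset of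
  \<open>e\<close> within one cluster lets \<open>alive\<close> remove the last vertex of any edge
  that meets \<open>e\<close> in a heavy set.\<close>

lemma cluster_decomposition:
  assumes "e \<in> kcomplement k V E"
  shows "\<exists>F\<subseteq>clusters. \<Union>F = e \<and> card F \<le> k \<and> (\<Sum>C\<in>F. card C) = k \<and>
    (\<forall>B\<in>heavy. B \<subseteq> e \<longrightarrow> (\<exists>C\<in>F. B \<subseteq> C))"
proof -
  have e: "e \<subseteq> V" "finite e" "card e = k" "e \<notin> E" "e \<in> nsets V k"
    using assms by (auto simp: kcomplement_def nsets_def)
  consider "e \<in> bi_heavy" | A where "e \<notin> bi_heavy" "A \<in> heavy" "A \<subseteq> e"
    | "\<forall>B\<in>heavy. \<not> B \<subseteq> e" by blast
  then show ?thesis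
  proof cases
    case 1
    then show ?thesis using e k by (intro exI[of _ "{e}"]) (auto simp: clusters_def)
  next
    case 2
    then have A: "card A = k - 1" "finite A" using heavyD by auto
    have c: "card (e - A) = 1" using e A 2 k by (simp add: card_Diff_subset)
    then obtain x where x: "e - A = {x}" by (auto simp: card_1_singleton_iff)
    have neq: "A \<noteq> {x}" using x by auto
    show ?thesis
    proof (intro exI[of _ "{A, {x}}"] conjI ballI impI)
      show "{A, {x}} \<subseteq> clusters" using x e 2 by (auto simp: clusters_def)
      show "\<Union> {A, {x}} = e" using x 2 by auto
      show "card {A, {x}} \<le> k" "(\<Sum>C\<in>{A, {x}}. card C) = k" using neq A k by auto
      fix B assume "B \<in> heavy" "B \<subseteq> e"
      \<comment> \<open>A second heavy subset would put \<open>e\<close> into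
        \<open>bi_heavy\<close>.\<close>
      then have "B = A" using 2 e by (auto simp: bi_heavy_def)
      then show "\<exists>C\<in>{A, {x}}. B \<subseteq> C" by simp
    qed
  next
    case 3
    let ?F = "(\<lambda>v. {v}) ` e"
    have "card ?F = k" using e by (subst card_image) (auto simp: inj_on_def)
    moreover have "(\<Sum>C\<in>?F. card C) = k" using e by (subst sum.reindex) (auto simp: inj_on_def)
    ultimately show ?thesis using 3 e by (intro exI[of _ ?F]) (auto simp: clusters_def)
  qed
qed

text \<open>An edge consisting of a chosen heavy set and one more vertex is destroyed by deleting that
  vertex, so that heavy sets survive. The edges that remain after this are rare, and all their vertices
  are deleted.\<close>

definition alive :: "'a set set \<Rightarrow> 'a set" where
  "alive D = {x \<in> \<Union>D. \<not> (\<exists>f\<in>E. x \<in> f \<and> f - {x} \<in> heavy \<and> (\<exists>C\<in>D. f - {x} \<subseteq> C))}"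

definition surviving :: "'a set set \<Rightarrow> 'a set" where
  "surviving D = {x \<in> alive D. \<not> (\<exists>f\<in>E. x \<in> f \<and> f \<subseteq> alive D)}"

text \<open>An edge inside \<open>surviving D\<close> would also lie in \<open>alive D\<close>, so
  none of its vertices would survive.\<close>

lemma independent_surviving:
  assumes "D \<subseteq> clusters"
  shows "independent V E (surviving D)"
  unfolding independent_def
proof (intro conjI ballI notI)
  have "C \<subseteq> V" if "C \<in> clusters" for C
    using that heavyD[of C] bi_heavyD[of C] by (auto simp: clusters_def)
  then have "\<Union>D \<subseteq> V" using assms by blast
  then show "surviving D \<subseteq> V" by (auto simp: surviving_def alive_def)
  fix f assume f: "f \<in> E" "f \<subseteq> surviving D"
  then have "f \<noteq> {}" using edgeD[of f] k by auto
  then show False using f by (auto simp: surviving_def)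
qed

text \<open>Two kinds of events threaten \<open>e\<close>: an edge through \<open>x \<in> e\<close>
  whose other vertices are all covered by \<open>D\<close>, which may delete \<open>x\<close> at
  once, and an edge meeting \<open>e\<close> in a non-heavy set whose remainder is covered by
  \<open>D\<close>. An edge meeting \<open>e\<close> in a heavy set is harmless: that set lies in
  one cluster of \<open>F\<close>, so the remaining vertex is not alive.\<close>

lemma subset_surviving:
  assumes e: "e \<in> kcomplement k V E" and F: "\<Union>F = e" "\<forall>B\<in>heavy. B \<subseteq> e \<longrightarrow> (\<exists>C\<in>F. B \<subseteq> C)"
    and 1: "\<not> (\<exists>p\<in>Sigma e (\<lambda>x. {f \<in> E. x \<in> f}). snd p - {fst p} \<subseteq> \<Union>D)"
    and 2: "\<not> (\<exists>f\<in>{f \<in> E. f \<inter> e \<noteq> {} \<and> f \<inter> e \<notin> heavy}. f - e \<subseteq> \<Union>D)"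
  shows "e \<subseteq> surviving (F \<union> D)"
proof
  fix x assume x: "x \<in> e"
  have eE: "e \<notin> E" "card e = k" "finite e" using e by (auto simp: kcomplement_def nsets_def)
  have alive: "x \<in> alive (F \<union> D)"
    unfolding alive_def
  proof (intro CollectI conjI notI)
    show "x \<in> \<Union> (F \<union> D)" using x F by auto
    assume "\<exists>f\<in>E. x \<in> f \<and> f - {x} \<in> heavy \<and> (\<exists>C\<in>F \<union> D. f - {x} \<subseteq> C)"
    then obtain f C where f: "f \<in> E" "x \<in> f" "C \<in> F \<union> D" "f - {x} \<subseteq> C" by blast
    show False
    proof (cases "C \<in> D")
      case True
      have "(x, f) \<in> Sigma e (\<lambda>x. {f \<in> E. x \<in> f})" using x f by auto
      moreover have "snd (x, f) - {fst (x, f)} \<subseteq> \<Union>D" using True f by auto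
      ultimately show False using 1 by blast
    next
      case False
      then have "f \<subseteq> e" using f F x by auto
      then have "f = e" using f edgeD eE by (intro card_subset_eq) auto
      then show False using f eE by simp
    qed
  qed
  moreover have "\<not> (\<exists>f\<in>E. x \<in> f \<and> f \<subseteq> alive (F \<union> D))"
  proof
    assume "\<exists>f\<in>E. x \<in> f \<and> f \<subseteq> alive (F \<union> D)"
    then obtain f where f: "f \<in> E" "x \<in> f" "f \<subseteq> alive (F \<union> D)" by blast
    show False
    proof (cases "f \<inter> e \<in> heavy")
      case True
      then obtain C where C: "C \<in> F" "f \<inter> e \<subseteq> C" using F by blast
      have "card (f - f \<inter> e) = 1"
        using f edgeD heavyD[OF True] k by (subst card_Diff_subset) auto
      then obtain y where y: "f - f \<inter> e = {y}" by (auto simp: card_1_singleton_iff)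
      then have fy: "f - {y} = f \<inter> e" "y \<in> f" by auto
      then have "f - {y} \<in> heavy" "f - {y} \<subseteq> C" using True C by auto
      then have "y \<notin> alive (F \<union> D)" using f(1) C(1) fy(2) unfolding alive_def by blast
      then show False using f fy by auto
    next
      case False
      moreover have "f - e \<subseteq> \<Union>D" using f F by (auto simp: alive_def)
      ultimately show False using 2 f x by blast
    qed
  qed
  ultimately show "x \<in> surviving (F \<union> D)" by (simp add: surviving_def)
qed

text \<open>Condition on all clusters of \<open>F\<close> being chosen, which has probability at
  least \<open>\<epsilon> ^ k * \<sigma> ^ k\<close>. The two failure events concern only the
  remaining clusters, and union bounds give them total probability at most 1/2.\<close>

lemma prob_surviving:
  assumes e: "e \<in> kcomplement k V E" and \<epsilon>: "0 < \<epsilon>" "\<epsilon> \<le> 1" "2 ^ k * ((1 + real k + real k ^ 3) * \<epsilon>) = 1 / (6 * k)"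
  shows "\<epsilon> ^ k * \<sigma> ^ k / 2 \<le> subset_prob (\<lambda>C. \<epsilon> * \<sigma> ^ card C) clusters (\<lambda>D. e \<subseteq> surviving D)"
proof -
  let ?q = "\<lambda>C::'a set. \<epsilon> * \<sigma> ^ card C"
  have eE: "e \<notin> E" "card e = k" "finite e" "e \<subseteq> V" using e by (auto simp: kcomplement_def nsets_def)
  obtain F where F: "F \<subseteq> clusters" "\<Union>F = e" "card F \<le> k" "(\<Sum>C\<in>F. card C) = k"
    "\<forall>B\<in>heavy. B \<subseteq> e \<longrightarrow> (\<exists>C\<in>F. B \<subseteq> C)"
    using cluster_decomposition[OF e] by blast
  define S where "S = clusters - F"
  have fin: "finite F" "finite S"
    using finite_subset[OF F(1) finite_families(4)] finite_families(4) by (auto simp: S_def)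
  have FS: "F \<inter> S = {}" "F \<union> S = clusters" using F by (auto simp: S_def)
  have q: "0 \<le> ?q C \<and> ?q C \<le> 1" for C
    using mult_mono[of \<epsilon> 1 "\<sigma> ^ card C" 1] power_le_one[of \<sigma> "card C"] \<sigma>(1,2) \<epsilon>(1,2) by simp
  \<comment> \<open>The value of \<open>2 ^ m * K\<close> in the covering bound. The failures have
    probability at most \<open>k * Q\<close> and \<open>2 * k * Q\<close>, together 1/2.\<close>
  define Q where "Q = 1 / (6 * real k)"
  have cover: "subset_prob ?q S (\<lambda>D. X \<subseteq> \<Union>D) \<le> Q * \<sigma> ^ card X"
    if X: "X \<noteq> {}" "finite X" "card X \<le> k" for X
  proof -
    have "(\<Sum>C | C \<in> S \<and> P \<subseteq> C. ?q C) \<le> (1 + real k + real k ^ 3) * \<epsilon> * \<sigma> ^ card P" if "P \<noteq> {}" for P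
    proof -
      have "(\<Sum>C | C \<in> S \<and> P \<subseteq> C. ?q C) \<le> (\<Sum>C | C \<in> clusters \<and> P \<subseteq> C. ?q C)"
        using finite_families q by (intro sum_mono2) (auto simp: S_def)
      then show ?thesis using cluster_spread[OF _ that, of \<epsilon>] \<epsilon> by simp
    qed
    moreover have "2 ^ k * ((1 + real k + real k ^ 3) * \<epsilon>) \<le> 1"
      unfolding \<epsilon>(3) using k by simp
    ultimately have "subset_prob ?q S (\<lambda>D. X \<subseteq> \<Union>D)
        \<le> (if X = {} then 1 else 2 ^ k * ((1 + real k + real k ^ 3) * \<epsilon>)) * \<sigma> ^ card X"
      using fin(2) q \<sigma>(1) \<epsilon>(1) X(2,3) by (intro subset_prob_cover) auto
    then show ?thesis unfolding \<epsilon>(3) using X(1) by (simp add: Q_def)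
  qed
  let ?J = "Sigma e (\<lambda>x. {f \<in> E. x \<in> f})"
  let ?G = "{f \<in> E. f \<inter> e \<noteq> {} \<and> f \<inter> e \<notin> heavy}"
  let ?fail1 = "\<lambda>D. \<exists>p\<in>?J. snd p - {fst p} \<subseteq> \<Union>D" and ?fail2 = "\<lambda>D. \<exists>f\<in>?G. f - e \<subseteq> \<Union>D"
  have Q: "0 \<le> Q" by (simp add: Q_def)
  have edeg: "real (\<Sum>x\<in>e. card {f \<in> E. x \<in> f}) \<le> k * d"
  proof -
    have "(\<Sum>x\<in>e. card {f \<in> E. x \<in> f}) \<le> (\<Sum>x\<in>e. d)"
      using eE deg by (intro sum_mono) auto
    then have "(\<Sum>x\<in>e. card {f \<in> E. x \<in> f}) \<le> k * d" using eE by simp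
    then show ?thesis by (metis of_nat_le_iff of_nat_mult)
  qed
  have fJ: "finite ?J" using eE finite_families by auto
  have fG: "finite ?G" using finite_families by auto
  \<comment> \<open>There are at most \<open>k * d\<close> pairs, each leaving
    \<open>k - 1 \<ge> 2\<close> vertices to cover, and
    \<open>d * \<sigma>\<^sup>2 = 1\<close>.\<close>
  have p1: "subset_prob ?q S ?fail1 \<le> k * Q"
  proof -
    have "subset_prob ?q S ?fail1 \<le> (\<Sum>p\<in>?J. subset_prob ?q S (\<lambda>D. snd p - {fst p} \<subseteq> \<Union>D))"
      by (rule subset_prob_Bex) (use fin q fJ in auto)
    also have "\<dots> \<le> (\<Sum>p\<in>?J. Q * \<sigma>\<^sup>2)"
    proof (rule sum_mono)
      fix p assume p: "p \<in> ?J"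
      then obtain x f where xf: "p = (x, f)" "f \<in> E" "x \<in> f" by auto
      have c: "finite (f - {x})" "card (f - {x}) = k - 1" using xf edgeD by auto
      moreover have "0 < card (f - {x})" unfolding c(2) using k by simp
      then have "f - {x} \<noteq> {}" unfolding card_gt_0_iff by blast
      ultimately have "subset_prob ?q S (\<lambda>D. f - {x} \<subseteq> \<Union>D) \<le> Q * \<sigma> ^ card (f - {x})"
        by (intro cover) (use c(2) k in auto)
      also have "\<dots> \<le> Q * \<sigma>\<^sup>2" using c k \<sigma> Q by (intro mult_left_mono power_decreasing) auto
      finally show "subset_prob ?q S (\<lambda>D. snd p - {fst p} \<subseteq> \<Union>D) \<le> Q * \<sigma>\<^sup>2" using xf by simp
    qed
    also have "\<dots> = real (\<Sum>x\<in>e. card {f \<in> E. x \<in> f}) * (Q * \<sigma>\<^sup>2)"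
      using eE finite_families by (simp add: card_SigmaI)
    also have "\<dots> \<le> (k * d) * (Q * \<sigma>\<^sup>2)" using edeg Q by (intro mult_right_mono) auto
    also have "\<dots> = k * Q * (d * \<sigma>\<^sup>2)" by (simp only: of_nat_mult mult_ac)
    finally show ?thesis using \<sigma> by simp
  qed
  have p2: "subset_prob ?q S ?fail2 \<le> 2 * k * Q"
  proof -
    \<comment> \<open>Edges meeting \<open>e\<close> in at most \<open>k - 2\<close> vertices leave
      at least two vertices to cover, and \<open>\<sigma>\<^sup>2\<close> pays for all
      \<open>k * d\<close> of them. Those meeting it in \<open>k - 1\<close> vertices leave only
      one, but the intersection is not heavy, so there are at most \<open>k * sqrt d\<close> of
      them.\<close>
    let ?A = "{f \<in> ?G. card (f \<inter> e) \<le> k - 2}" and ?B = "{f \<in> ?G. card (f \<inter> e) = k - 1}"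
    have lt: "card (f \<inter> e) < k" if "f \<in> E" for f
    proof (rule ccontr)
      assume "\<not> ?thesis"
      then have "f \<inter> e = f" "f \<inter> e = e"
        using card_seteq[of f "f \<inter> e"] card_seteq[of e "f \<inter> e"] edgeD[OF that] eE by auto
      then show False using that eE by auto
    qed
    have cd: "card (f - e) = k - card (f \<inter> e)" "finite (f - e)" "f - e \<noteq> {}" if "f \<in> E" for f
    proof -
      show *: "card (f - e) = k - card (f \<inter> e)" "finite (f - e)"
        using edgeD[OF that] by (auto simp: card_Diff_subset_Int)
      show "f - e \<noteq> {}" using * lt[OF that] by force
    qed
    have "subset_prob ?q S ?fail2 \<le> (\<Sum>f\<in>?G. subset_prob ?q S (\<lambda>D. f - e \<subseteq> \<Union>D))"
      by (rule subset_prob_Bex) (use fin q fG in auto)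
    also have "\<dots> \<le> (\<Sum>f\<in>?G. Q * \<sigma> ^ card (f - e))"
      using cd by (intro sum_mono cover) auto
    also have "(\<Sum>f\<in>?G. Q * \<sigma> ^ card (f - e)) = (\<Sum>f\<in>?A \<union> ?B. Q * \<sigma> ^ card (f - e))"
      using lt by (intro sum.cong) fastforce+
    also have "\<dots>
        \<le> (\<Sum>f\<in>?A. Q * \<sigma> ^ card (f - e)) + (\<Sum>f\<in>?B. Q * \<sigma> ^ card (f - e))"
      using finite_families(1) Q \<sigma> by (intro sum_Un_le) auto
    also have "(\<Sum>f\<in>?A. Q * \<sigma> ^ card (f - e)) \<le> (\<Sum>f\<in>?A. Q * \<sigma>\<^sup>2)"
    proof (intro sum_mono mult_left_mono power_decreasing)
      fix f assume f: "f \<in> ?A"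
      then show "2 \<le> card (f - e)" using cd(1)[of f] k by auto
    qed (use Q \<sigma> in auto)
    also have "\<dots> = card ?A * (Q * \<sigma>\<^sup>2)" by simp
    also have "\<dots> \<le> (k * d) * (Q * \<sigma>\<^sup>2)"
    proof (rule mult_right_mono)
      have "card ?A \<le> card (\<Union>x\<in>e. {f \<in> E. x \<in> f})"
        using eE finite_families by (intro card_mono) auto
      also have "\<dots> \<le> (\<Sum>x\<in>e. card {f \<in> E. x \<in> f})" using eE by (intro card_UN_le) auto
      finally show "real (card ?A) \<le> k * d" using edeg by linarith
    qed (use Q in auto)
    also have "\<dots> = k * Q * (d * \<sigma>\<^sup>2)" by (simp only: of_nat_mult mult_ac)
    also have "\<dots> = k * Q" using \<sigma> by simp
    also have "(\<Sum>f\<in>?B. Q * \<sigma> ^ card (f - e)) = (\<Sum>f\<in>?B. Q * \<sigma>)"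
      using cd(1) k by (intro sum.cong) auto
    also have "\<dots> = card ?B * (Q * \<sigma>)" by simp
    also have "\<dots> \<le> (k * sqrt d) * (Q * \<sigma>)"
    proof (rule mult_right_mono)
      let ?N = "nsets e (k - 1) - heavy"
      have fN: "finite (nsets e (k - 1))" using eE by (intro finite_imp_finite_nsets)
      have "?B \<subseteq> (\<Union>B\<in>?N. {f \<in> E. B \<subseteq> f})"
      proof
        fix f assume "f \<in> ?B"
        then have "f \<inter> e \<in> ?N" "f \<in> E" "f \<inter> e \<subseteq> f" using eE by (auto simp: nsets_def)
        then show "f \<in> (\<Union>B\<in>?N. {f \<in> E. B \<subseteq> f})" by blast
      qed
      then have "real (card ?B) \<le> real (card (\<Union>B\<in>?N. {f \<in> E. B \<subseteq> f}))"
        using fN finite_families by (intro of_nat_mono card_mono) auto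
      also have "\<dots> \<le> card ?N * sqrt d"
      proof (rule card_UN_le_mult)
        fix B assume B: "B \<in> ?N"
        then have "B \<in> nsets V (k - 1)" using eE nsets_mono by blast
        then show "real (card {f \<in> E. B \<subseteq> f}) \<le> sqrt d" using B by (auto simp: heavy_def not_less)
      qed (use fN in auto)
      also have "\<dots> \<le> k * sqrt d"
      proof (rule mult_right_mono)
        have "card ?N \<le> card (nsets e (k - 1))" using fN by (intro card_mono) auto
        also have "\<dots> = k" using eE k binomial_symmetric[of "k - 1" k] by simp
        finally show "real (card ?N) \<le> k" by simp
      qed simp
      finally show "real (card ?B) \<le> k * sqrt d" .
    qed (use Q \<sigma> in auto)
    also have "\<dots> = k * Q * (sqrt d * \<sigma>)" by (simp only: mult_ac)
    also have "\<dots> = k * Q" using \<sigma> by simp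
    finally show ?thesis by (simp add: algebra_simps)
  qed
  have "subset_prob ?q S (\<lambda>D. ?fail1 D \<or> ?fail2 D) \<le> subset_prob ?q S ?fail1 + subset_prob ?q S ?fail2"
    using fin q by (intro subset_prob_disj) auto
  also have "\<dots> \<le> 1 / 2" using p1 p2 k by (simp add: Q_def)
  finally have half: "1 / 2 \<le> subset_prob ?q S (\<lambda>D. \<not> (?fail1 D \<or> ?fail2 D))"
    using fin by (simp only: subset_prob_not)
  have "(\<Prod>C\<in>F. ?q C) = \<epsilon> ^ card F * \<sigma> ^ k"
    using F by (simp add: prod.distrib power_sum[symmetric])
  moreover have "\<epsilon> ^ k \<le> \<epsilon> ^ card F" using \<epsilon> F by (intro power_decreasing) auto
  ultimately have "\<epsilon> ^ k * \<sigma> ^ k \<le> (\<Prod>C\<in>F. ?q C)" using \<sigma> by (simp add: mult_right_mono)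
  then have "(\<epsilon> ^ k * \<sigma> ^ k) * (1 / 2) \<le> (\<Prod>C\<in>F. ?q C) * subset_prob ?q S (\<lambda>D. \<not> (?fail1 D \<or> ?fail2 D))"
    using half q \<epsilon> \<sigma> by (intro mult_mono prod_nonneg) auto
  also have "\<dots> \<le> (\<Prod>C\<in>F. ?q C) * subset_prob ?q S (\<lambda>D. e \<subseteq> surviving (F \<union> D))"
    using fin q subset_surviving[OF e F(2) F(5)]
    by (intro mult_left_mono subset_prob_mono prod_nonneg) blast+
  also have "\<dots> \<le> subset_prob ?q (F \<union> S) (\<lambda>D. e \<subseteq> surviving D)"
    by (rule subset_prob_superset) (use fin FS(1) q in auto)
  finally show ?thesis using FS by simp
qed

section \<open>A small cover from the survival probability\<close>

lemma theta_upper: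
  assumes \<epsilon>: "0 < \<epsilon>" "\<epsilon> \<le> 1" "2 ^ k * ((1 + real k + real k ^ 3) * \<epsilon>) = 1 / (6 * k)"
    and n: "card V = n" "3 \<le> n"
  shows "theta k V E \<le> 2 * (k + 1) / \<epsilon> ^ k * real d powr (k / 2) * ln n"
proof -
  let ?q = "\<lambda>C::'a set. \<epsilon> * \<sigma> ^ card C"
  let ?U = "kcomplement k V E"
  define \<delta> where "\<delta> = \<epsilon> ^ k * \<sigma> ^ k / 2"
  have \<delta>: "0 < \<delta>" "\<delta> \<le> 1"
  proof -
    show "0 < \<delta>" using \<epsilon> \<sigma> by (simp add: \<delta>_def)
    have "\<epsilon> ^ k * \<sigma> ^ k \<le> 1" using \<epsilon> \<sigma> by (intro mult_le_one power_le_one) auto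
    then show "\<delta> \<le> 1" by (simp add: \<delta>_def)
  qed
  have q: "0 \<le> ?q C \<and> ?q C \<le> 1" for C
    using mult_mono[of \<epsilon> 1 "\<sigma> ^ card C" 1] power_le_one[of \<sigma> "card C"] \<sigma>(1,2) \<epsilon>(1,2) by simp
  \<comment> \<open>Makes \<open>n ^ k * (1 - \<delta>) ^ t\<close> smaller than 1, so that no
    non-edge is left over; the added 1 gives strictness and \<open>1 \<le> t\<close>.\<close>
  define t where "t = nat \<lfloor>k * ln n / \<delta>\<rfloor> + 1"
  have ln1: "1 \<le> ln (real n)"
  proof -
    have "exp 1 \<le> real n" using n(2) exp_le by linarith
    then show ?thesis using n(2) by (subst ln_ge_iff) auto
  qed
  have t: "k * ln n / \<delta> < t" "t \<le> k * ln n / \<delta> + 1"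
  proof -
    have "0 \<le> k * ln n / \<delta>" using ln1 \<delta> by simp
    then show "k * ln n / \<delta> < t" "t \<le> k * ln n / \<delta> + 1" unfolding t_def by linarith+
  qed
  have fU: "finite ?U" using finV by (simp add: kcomplement_def finite_imp_finite_nsets)
  have "\<exists>g. (\<forall>j\<in>{1..t}. g j \<in> Pow clusters) \<and>
      real (card {u \<in> ?U. \<forall>j\<in>{1..t}. \<not> u \<subseteq> surviving (g j)}) \<le> real (card ?U) * (1 - \<delta>) ^ t"
  proof (rule greedy_cover[where W = "subset_weight ?q clusters"])
    show "sum (subset_weight ?q clusters) (Pow clusters) = 1"
      using subset_prob_True[OF finite_families(4), of ?q] by (simp add: subset_prob_def Pow_def)
    fix u assume "u \<in> ?U"
    then show "\<delta> \<le> (\<Sum>D | D \<in> Pow clusters \<and> u \<subseteq> surviving D. subset_weight ?q clusters D)"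
      using prob_surviving[OF _ \<epsilon>] by (simp add: subset_prob_def \<delta>_def)
  qed (use finite_families fU \<delta> q in \<open>auto intro!: subset_weight_nonneg\<close>)
  then obtain g where g: "\<forall>j\<in>{1..t}. g j \<subseteq> clusters"
    "real (card {u \<in> ?U. \<forall>j\<in>{1..t}. \<not> u \<subseteq> surviving (g j)}) \<le> real (card ?U) * (1 - \<delta>) ^ t"
    by auto
  have "card ?U \<le> card (nsets V k)"
    using finV by (intro card_mono) (auto simp: kcomplement_def finite_imp_finite_nsets)
  also have "\<dots> \<le> n ^ k"
    using n(1) by (cases "k \<le> n") (auto simp: binomial_le_pow binomial_eq_0)
  finally have "card ?U \<le> n ^ k" .
  then have "real (card ?U) \<le> real n ^ k" by (metis of_nat_le_iff of_nat_power)
  moreover have "(1 - \<delta>) ^ t \<le> exp (- \<delta> * t)"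
  proof -
    have "(1 - \<delta>) ^ t \<le> exp (- \<delta>) ^ t" using \<delta> exp_ge_add_one_self[of "- \<delta>"] by (intro power_mono) auto
    then show ?thesis by (simp add: exp_of_nat_mult[symmetric] mult.commute)
  qed
  ultimately have "real (card ?U) * (1 - \<delta>) ^ t \<le> real n ^ k * exp (- \<delta> * t)"
    using \<delta> by (intro mult_mono) auto
  also have "\<dots> = exp (k * ln n - \<delta> * t)"
    using n by (simp add: exp_diff exp_of_nat_mult exp_minus field_simps)
  also have "\<dots> < 1" using t \<delta> by (simp add: field_simps)
  finally have "card {u \<in> ?U. \<forall>j\<in>{1..t}. \<not> u \<subseteq> surviving (g j)} = 0" using g by linarith
  then have "{u \<in> ?U. \<forall>j\<in>{1..t}. \<not> u \<subseteq> surviving (g j)} = {}" using fU by auto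
  then have "covers k V E t (\<lambda>j. surviving (g j))"
    unfolding covers_def using g independent_surviving by auto
  then have "theta k V E \<le> t" by (rule theta_le) (simp add: t_def)
  then have "real (theta k V E) \<le> k * ln n / \<delta> + 1" using t by linarith
  \<comment> \<open>\<open>\<delta> \<le> 1 \<le> ln n\<close>, from \<open>3 \<le> n\<close>,
    absorbs the rounding term.\<close>
  also have "\<dots> \<le> k * ln n / \<delta> + ln n / \<delta>"
  proof -
    have "\<delta> \<le> ln n" using ln1 \<delta> by linarith
    then show ?thesis using \<delta> by simp
  qed
  also have "\<dots> = (k + 1) * ln n / \<delta>"
    by (simp add: add_divide_distrib[symmetric] algebra_simps)
  also have "1 / \<delta> = 2 / \<epsilon> ^ k * real d powr (k / 2)"
  proof -
    have "real d powr (k / 2) = (real d powr (1 / 2)) powr k" by (simp add: powr_powr)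
    also have "\<dots> = sqrt d ^ k" using d by (simp add: powr_half_sqrt powr_realpow)
    finally show ?thesis by (simp add: \<delta>_def \<sigma>_def power_divide)
  qed
  then have "(k + 1) * ln n / \<delta> = (k + 1) * ln n * (2 / \<epsilon> ^ k * real d powr (k / 2))"
    by (metis mult.right_neutral times_divide_eq_right)
  then have "(k + 1) * ln n / \<delta> = 2 * (k + 1) / \<epsilon> ^ k * real d powr (k / 2) * ln n"
    by simp
  finally show ?thesis .
qed

end

subsection \<open>Counting matchings between disjoint cliques\<close>

locale clique_matchings =
  fixes k b r :: nat
  assumes k: "2 \<le> k"
begin

text \<open>In \<open>(i, a, x)\<close>, \<open>i\<close> is the part, \<open>a\<close> the block
  within it and \<open>x\<close> the position in the block. A block fixes \<open>(i, a)\<close> and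
  a clique fixes \<open>(i, x)\<close>, so a block and a clique share at most one vertex.\<close>

definition verts :: "(nat \<times> nat \<times> nat) set" where
  "verts = {..<k} \<times> {..<b} \<times> {..<r}"

definition cliques :: "(nat \<times> nat \<times> nat) set set" where
  "cliques = {e \<in> nsets verts k. \<exists>i x. e \<subseteq> {i} \<times> {..<b} \<times> {x}}"

text \<open>\<open>\<alpha> i\<close> is the block that the cell \<open>\<alpha>\<close> takes from
  part \<open>i\<close>.\<close>

definition cells :: "(nat \<Rightarrow> nat) set" where
  "cells = {..<k} \<rightarrow>\<^sub>E {..<b}"

definition matchings :: "((nat \<Rightarrow> nat) \<Rightarrow> nat \<Rightarrow> nat) set" where
  "matchings = cells \<rightarrow>\<^sub>E {p. p permutes {..<r}}"

text \<open>One perfect matching between the blocks of each cell; its freedom is a permutation of the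
  vertices of the block in part 0.\<close>

definition transversal :: "((nat \<Rightarrow> nat) \<Rightarrow> nat \<Rightarrow> nat) \<Rightarrow> (nat \<Rightarrow> nat) \<Rightarrow> nat \<Rightarrow> (nat \<times> nat \<times> nat) set" where
  "transversal p \<alpha> x = (\<lambda>i. (i, \<alpha> i, if i = 0 then p \<alpha> x else x)) ` {..<k}"

definition edges :: "((nat \<Rightarrow> nat) \<Rightarrow> nat \<Rightarrow> nat) \<Rightarrow> (nat \<times> nat \<times> nat) set set" where
  "edges p = cliques \<union> {transversal p \<alpha> x | \<alpha> x. \<alpha> \<in> cells \<and> x < r}"

lemma finite_cells: "finite cells" "card cells = b ^ k"
  by (auto simp: cells_def finite_PiE card_PiE)

lemma finite_verts: "finite verts" "card verts = k * b * r"
  by (auto simp: verts_def card_cartesian_product)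

lemma card_matchings: "finite matchings" "card matchings = fact r ^ (b ^ k)"
  using finite_cells
  by (auto simp: matchings_def card_PiE finite_PiE finite_permutations card_permutations[OF refl])

lemma transversal_in:
  assumes "p \<in> matchings" "\<alpha> \<in> cells" "x < r"
  shows "transversal p \<alpha> x \<in> nsets verts k"
proof -
  have "p \<alpha> permutes {..<r}" using assms by (auto simp: matchings_def)
  then have "p \<alpha> x < r" using assms permutes_in_image[of "p \<alpha>" "{..<r}" x] by auto
  moreover have "\<alpha> i < b" if "i < k" for i using assms that by (auto simp: cells_def)
  ultimately have "transversal p \<alpha> x \<subseteq> verts" using assms by (auto simp: transversal_def verts_def)
  moreover have "card (transversal p \<alpha> x) = k"
    unfolding transversal_def by (subst card_image) (auto simp: inj_on_def)
  ultimately show ?thesis by (auto simp: nsets_def transversal_def)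
qed

lemma mem_transversal:
  "(i, a, y) \<in> transversal p \<alpha> x \<longleftrightarrow> i < k \<and> a = \<alpha> i \<and> y = (if i = 0 then p \<alpha> x else x)"
  by (auto simp: transversal_def)

lemma transversal_not_clique: "transversal p \<alpha> x \<notin> cliques"
proof
  assume "transversal p \<alpha> x \<in> cliques"
  then obtain i y where "transversal p \<alpha> x \<subseteq> {i} \<times> {..<b} \<times> {y}" by (auto simp: cliques_def)
  moreover have "(0, \<alpha> 0, p \<alpha> x) \<in> transversal p \<alpha> x" "(1, \<alpha> 1, x) \<in> transversal p \<alpha> x"
    using k by (auto simp: mem_transversal)
  ultimately show False by auto
qed

text \<open>The first coordinate tells the parts apart. Part 1, which exists as
  \<open>2 \<le> k\<close>, is not permuted and shows \<open>x\<close>; part 0 then shows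
  \<open>p \<alpha> x\<close>.\<close>

lemma transversal_eqD:
  assumes eq: "transversal p \<alpha> x = transversal p' \<alpha>' x'" and "\<alpha> \<in> cells" "\<alpha>' \<in> cells"
  shows "\<alpha> = \<alpha>'" "x = x'" "p \<alpha> x = p' \<alpha>' x'"
proof -
  have *: "\<alpha> i = \<alpha>' i \<and> (if i = 0 then p \<alpha> x else x) = (if i = 0 then p' \<alpha>' x' else x')" if "i < k" for i
  proof -
    have "(i, \<alpha> i, if i = 0 then p \<alpha> x else x) \<in> transversal p \<alpha> x" using that by (simp add: mem_transversal)
    then show ?thesis unfolding eq mem_transversal by blast
  qed
  show "\<alpha> = \<alpha>'"
    by (rule PiE_ext[of _ "{..<k}" "\<lambda>_. {..<b}"]) (use assms(2,3) * in \<open>auto simp: cells_def\<close>)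
  show "x = x'" using *[of 1] k by simp
  show "p \<alpha> x = p' \<alpha>' x'" using *[of 0] k by simp
qed

text \<open>Transversal edges are never clique edges, so the edge set reveals each matching on
  \<open>{..<r}\<close>; outside, the permutations are the identity.\<close>

lemma inj_on_edges: "inj_on edges matchings"
proof (rule inj_onI)
  fix p p' assume p: "p \<in> matchings" "p' \<in> matchings" and eq: "edges p = edges p'"
  have "p \<alpha> x = p' \<alpha> x" if \<alpha>: "\<alpha> \<in> cells" for \<alpha> x
  proof (cases "x < r")
    case True
    then have "transversal p \<alpha> x \<in> edges p" using \<alpha> by (auto simp: edges_def)
    then have "transversal p \<alpha> x \<in> edges p'" unfolding eq .
    then obtain \<alpha>' x' where "\<alpha>' \<in> cells" "transversal p \<alpha> x = transversal p' \<alpha>' x'"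
      using transversal_not_clique by (auto simp: edges_def)
    then show ?thesis using transversal_eqD[of p \<alpha> x p' \<alpha>' x'] \<alpha> by simp
  next
    case False
    have "p \<alpha> permutes {..<r}" "p' \<alpha> permutes {..<r}" using p \<alpha> by (auto simp: matchings_def)
    then show ?thesis using False by (simp add: permutes_not_in)
  qed
  then have "p \<alpha> = p' \<alpha>" if "\<alpha> \<in> cells" for \<alpha> using that by blast
  then show "p = p'" using p unfolding matchings_def by (intro PiE_ext[of p cells _ p'])
qed

lemma edges_kgraph:
  assumes "p \<in> matchings"
  shows "kgraph k verts (edges p)"
  unfolding kgraph_def
proof (intro conjI subsetI finite_verts(1))
  fix e assume "e \<in> edges p"
  then consider "e \<in> cliques" | \<alpha> x where "\<alpha> \<in> cells" "x < r" "e = transversal p \<alpha> x"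
    unfolding edges_def by blast
  then show "e \<in> nsets verts k"
  proof cases
    case 1 then show ?thesis by (simp add: cliques_def)
  next
    case 2 then show ?thesis using transversal_in[OF assms] by simp
  qed
qed

lemma card_cells_through:
  assumes "i < k"
  shows "card {\<alpha> \<in> cells. \<alpha> i = a} \<le> b ^ (k - 1)"
proof -
  let ?J = "{..<k} - {i}"
  have "inj_on (\<lambda>\<alpha>. restrict \<alpha> ?J) {\<alpha> \<in> cells. \<alpha> i = a}"
  proof (rule inj_onI)
    fix \<alpha> \<beta> assume A: "\<alpha> \<in> {\<alpha> \<in> cells. \<alpha> i = a}" "\<beta> \<in> {\<alpha> \<in> cells. \<alpha> i = a}"
      and eq: "restrict \<alpha> ?J = restrict \<beta> ?J"
    show "\<alpha> = \<beta>"
    proof (rule PiE_ext[of _ "{..<k}" "\<lambda>_. {..<b}"])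
      show "\<alpha> \<in> {..<k} \<rightarrow>\<^sub>E {..<b}" "\<beta> \<in> {..<k} \<rightarrow>\<^sub>E {..<b}"
        using A by (simp_all add: cells_def)
      show "\<alpha> j = \<beta> j" if "j \<in> {..<k}" for j
      proof (cases "j = i")
        case False
        then have "restrict \<alpha> ?J j = \<alpha> j" "restrict \<beta> ?J j = \<beta> j" using that by auto
        then show ?thesis using eq by metis
      qed (use A in auto)
    qed
  qed
  moreover have "(\<lambda>\<alpha>. restrict \<alpha> ?J) ` {\<alpha> \<in> cells. \<alpha> i = a} \<subseteq> ?J \<rightarrow>\<^sub>E {..<b}"
  proof (intro image_subsetI PiE_I)
    fix \<alpha> j assume "\<alpha> \<in> {\<alpha> \<in> cells. \<alpha> i = a}" and j: "j \<in> ?J"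
    then have "\<alpha> j \<in> {..<b}" by (intro PiE_mem[of \<alpha> "{..<k}"]) (simp_all add: cells_def)
    then show "restrict \<alpha> ?J j \<in> {..<b}" using j by simp
  qed auto
  ultimately have "card {\<alpha> \<in> cells. \<alpha> i = a} \<le> card (?J \<rightarrow>\<^sub>E {..<b})"
    by (rule card_inj_on_le) (auto intro: finite_PiE)
  then show ?thesis using assms by (simp add: card_PiE)
qed

text \<open>A clique edge at \<open>v\<close> is fixed by \<open>k - 1\<close> further vertices of
  the clique of \<open>v\<close>. Each cell through the block of \<open>v\<close> adds one edge,
  whose position is determined by \<open>x\<close>, in part 0 via the inverse permutation. Each kind
  accounts for half of the bound.\<close>

lemma degree_edges:
  assumes p: "p \<in> matchings" and v: "v \<in> verts"
  shows "card {e \<in> edges p. v \<in> e} \<le> 2 * b ^ (k - 1)"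
proof -
  obtain i a x where v_eq: "v = (i, a, x)" and iax: "i < k" "a < b" "x < r"
    using v by (auto simp: verts_def)
  let ?C = "{e \<in> cliques. v \<in> e}" and ?A = "{\<alpha> \<in> cells. \<alpha> i = a}"
  let ?t = "\<lambda>\<alpha>. transversal p \<alpha> (if i = 0 then inv (p \<alpha>) x else x)"
  have "{e \<in> edges p. v \<in> e} \<subseteq> ?C \<union> ?t ` ?A"
  proof
    fix e assume e: "e \<in> {e \<in> edges p. v \<in> e}"
    show "e \<in> ?C \<union> ?t ` ?A"
    proof (cases "e \<in> cliques")
      case False
      then obtain \<alpha> y where \<alpha>: "\<alpha> \<in> cells" "y < r" "e = transversal p \<alpha> y"
        using e by (auto simp: edges_def)
      then have *: "\<alpha> i = a" "x = (if i = 0 then p \<alpha> y else y)"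
        using e v_eq by (auto simp: mem_transversal)
      have "p \<alpha> permutes {..<r}" using p \<alpha>(1) by (auto simp: matchings_def)
      then have "y = (if i = 0 then inv (p \<alpha>) x else x)"
        using *(2) permutes_inverses(2)[of "p \<alpha>" "{..<r}" y] by simp
      then have "e = ?t \<alpha>" using \<alpha>(3) by simp
      moreover have "\<alpha> \<in> ?A" using *(1) \<alpha>(1) by simp
      ultimately show ?thesis by blast
    qed (use e in auto)
  qed
  moreover have fin: "finite ?C" "finite (?t ` ?A)"
  proof -
    have "?C \<subseteq> nsets verts k" by (auto simp: cliques_def)
    then show "finite ?C" by (rule finite_subset) (intro finite_imp_finite_nsets finite_verts)
    show "finite (?t ` ?A)" using finite_cells by simp
  qed
  ultimately have "card {e \<in> edges p. v \<in> e} \<le> card (?C \<union> ?t ` ?A)"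
    by (intro card_mono) auto
  also have "\<dots> \<le> card ?C + card (?t ` ?A)" by (rule card_Un_le)
  also have "card (?t ` ?A) \<le> card ?A" using finite_cells by (intro card_image_le) auto
  also have "\<dots> \<le> b ^ (k - 1)" using iax(1) by (rule card_cells_through)
  also have "card ?C \<le> b ^ (k - 1)"
  proof -
    let ?B = "{i} \<times> {..<b} \<times> {x}"
    have "(\<lambda>e. e - {v}) ` ?C \<subseteq> nsets ?B (k - 1)"
    proof
      fix g assume "g \<in> (\<lambda>e. e - {v}) ` ?C"
      then obtain e j y where e: "g = e - {v}" "v \<in> e" "finite e" "card e = k"
        "e \<subseteq> {j} \<times> {..<b} \<times> {y}" by (auto simp: cliques_def nsets_def)
      then have "e \<subseteq> ?B" using v_eq by auto
      then show "g \<in> nsets ?B (k - 1)" using e by (auto simp: nsets_def)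
    qed
    moreover have "inj_on (\<lambda>e. e - {v}) ?C"
    proof (rule inj_onI)
      fix e e' assume "e \<in> ?C" "e' \<in> ?C" "e - {v} = e' - {v}"
      then show "e = e'" using insert_Diff[of v e] insert_Diff[of v e'] by simp
    qed
    moreover have "finite (nsets ?B (k - 1))" by (intro finite_imp_finite_nsets) auto
    ultimately have "card ?C \<le> card (nsets ?B (k - 1))" by (intro card_inj_on_le)
    also have "\<dots> = b choose (k - 1)" by (simp add: card_cartesian_product)
    also have "\<dots> \<le> b ^ (k - 1)"
      by (cases "k - 1 \<le> b") (auto simp: binomial_le_pow binomial_eq_0)
    finally show ?thesis .
  qed
  finally show ?thesis by simp
qed

section \<open>Counting independent sets and covers\<close>

text \<open>Involves the cliques only, hence contains the independent sets of all graphs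
  \<open>edges p\<close> at once.\<close>

definition sparse_sets :: "(nat \<times> nat \<times> nat) set set" where
  "sparse_sets = {I. I \<subseteq> verts \<and> (\<forall>i x. card {a. (i, a, x) \<in> I} \<le> k - 1)}"

lemma independent_sparse:
  assumes "independent verts (edges p) I"
  shows "I \<in> sparse_sets"
proof -
  have I: "I \<subseteq> verts" "\<And>e. e \<in> edges p \<Longrightarrow> \<not> e \<subseteq> I" using assms by (auto simp: independent_def)
  have "card {a. (i, a, x) \<in> I} \<le> k - 1" for i x
  proof (rule ccontr)
    let ?S = "{a. (i, a, x) \<in> I}"
    assume "\<not> ?thesis"
    then have "k \<le> card ?S" by simp
    then obtain S where S: "S \<subseteq> ?S" "card S = k" "finite S" using obtain_subset_with_card_n by metis
    let ?e = "{i} \<times> S \<times> {x}"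
    have sub: "?e \<subseteq> I" using S by auto
    then have "?e \<subseteq> {i} \<times> {..<b} \<times> {x}" using I by (fastforce simp: verts_def)
    moreover have "?e \<in> nsets verts k" using sub I(1) S by (auto simp: nsets_def card_cartesian_product)
    ultimately have "?e \<in> cliques" unfolding cliques_def by blast
    then show False using I(2)[of ?e] sub by (simp add: edges_def)
  qed
  then show ?thesis using I by (auto simp: sparse_sets_def)
qed

text \<open>A set is determined by its traces on the \<open>k * r\<close> cliques, and each trace is
  one of at most \<open>(b + 1) ^ (k - 1)\<close> small subsets.\<close>

lemma card_sparse_sets: "finite sparse_sets" "card sparse_sets \<le> ((b + 1) ^ (k - 1)) ^ (k * r)"
proof -
  show "finite sparse_sets"
    by (rule finite_subset[of _ "Pow verts"]) (use finite_verts in \<open>auto simp: sparse_sets_def\<close>)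
  let ?D = "{..<k} \<times> {..<r}"
  let ?S = "{S. S \<subseteq> {..<b} \<and> card S \<le> k - 1}"
  let ?g = "\<lambda>I. restrict (\<lambda>(i, x). {a. (i, a, x) \<in> I}) ?D"
  have S: "finite ?S" "card ?S \<le> (b + 1) ^ (k - 1)" using card_subsets_card_le[of "{..<b}" "k - 1"] by auto
  have "inj_on ?g sparse_sets"
  proof (rule inj_onI)
    fix I J assume IJ: "I \<in> sparse_sets" "J \<in> sparse_sets" and eq: "?g I = ?g J"
    have sub: "I \<subseteq> verts" "J \<subseteq> verts" using IJ by (auto simp: sparse_sets_def)
    have "(i, a, x) \<in> I \<longleftrightarrow> (i, a, x) \<in> J" for i a x
    proof (cases "(i, x) \<in> ?D")
      case True
      then have "{a. (i, a, x) \<in> I} = {a. (i, a, x) \<in> J}" using fun_cong[OF eq, of "(i, x)"] by simp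
      then show ?thesis by blast
    next
      case False
      then show ?thesis using sub by (auto simp: verts_def)
    qed
    then show "I = J" by auto
  qed
  moreover have "?g ` sparse_sets \<subseteq> ?D \<rightarrow>\<^sub>E ?S"
  proof (intro image_subsetI PiE_I)
    fix I z assume I: "I \<in> sparse_sets" and z: "z \<in> ?D"
    then obtain i x where ix: "z = (i, x)" by auto
    have "{a. (i, a, x) \<in> I} \<subseteq> {..<b}" using I by (auto simp: sparse_sets_def verts_def)
    then show "?g I z \<in> ?S" using I z ix by (auto simp: sparse_sets_def)
  qed auto
  ultimately have "card sparse_sets \<le> card (?D \<rightarrow>\<^sub>E ?S)"
    by (rule card_inj_on_le) (use S in \<open>auto intro: finite_PiE\<close>)
  also have "\<dots> = card ?S ^ (k * r)" by (simp add: card_PiE card_cartesian_product)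
  also have "\<dots> \<le> ((b + 1) ^ (k - 1)) ^ (k * r)" using S by (intro power_mono) auto
  finally show "card sparse_sets \<le> ((b + 1) ^ (k - 1)) ^ (k * r)" .
qed

text \<open>A cover determines its graph: edges lie in no \<open>I j\<close>, all other
  \<open>k\<close>-sets in some.\<close>

lemma edges_from_cover:
  assumes "p \<in> matchings" "covers k verts (edges p) T I"
  shows "edges p = {e \<in> nsets verts k. \<forall>j\<in>{1..T}. \<not> e \<subseteq> I j}"
proof -
  have "edges p \<subseteq> nsets verts k" using edges_kgraph[OF assms(1)] by (simp add: kgraph_def)
  then show ?thesis using assms(2) unfolding covers_def independent_def kcomplement_def by blast
qed

text \<open>Since a cover determines its graph, and the graph its matchings, choosing one cover for
  each \<open>p\<close> embeds \<open>matchings\<close> into the \<open>T\<close>-tuples of sparse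
  sets.\<close>

lemma fact_le_covers:
  assumes "\<And>p. p \<in> matchings \<Longrightarrow> \<exists>I. covers k verts (edges p) T I"
  shows "fact r ^ (b ^ k) \<le> (((b + 1) ^ (k - 1)) ^ (k * r)) ^ T"
proof -
  have "\<exists>f. \<forall>p\<in>matchings. covers k verts (edges p) T (f p)"
    using assms by (intro bchoice) auto
  then obtain f where f: "\<And>p. p \<in> matchings \<Longrightarrow> covers k verts (edges p) T (f p)" by blast
  \<comment> \<open>Values outside \<open>{1..T}\<close> are arbitrary and would spoil the
    count.\<close>
  let ?g = "\<lambda>p. restrict (f p) {1..T}"
  have "inj_on ?g matchings"
  proof (rule inj_onI)
    fix p p' assume p: "p \<in> matchings" "p' \<in> matchings" and eq: "?g p = ?g p'"
    have "f p j = f p' j" if "j \<in> {1..T}" for j using fun_cong[OF eq, of j] that by simp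
    then have "edges p = edges p'"
      using edges_from_cover[OF p(1) f[OF p(1)]] edges_from_cover[OF p(2) f[OF p(2)]] by simp
    then show "p = p'" using p inj_on_edges by (auto dest: inj_onD)
  qed
  moreover have "?g ` matchings \<subseteq> {1..T} \<rightarrow>\<^sub>E sparse_sets"
  proof
    fix h assume "h \<in> ?g ` matchings"
    then obtain p where p: "p \<in> matchings" "h = ?g p" by blast
    have "f p j \<in> sparse_sets" if "j \<in> {1..T}" for j
      using f[OF p(1)] that by (intro independent_sparse[of p]) (auto simp: covers_def)
    then show "h \<in> {1..T} \<rightarrow>\<^sub>E sparse_sets" using p by auto
  qed
  ultimately have "card matchings \<le> card ({1..T} \<rightarrow>\<^sub>E sparse_sets)"
    by (rule card_inj_on_le) (use card_sparse_sets in \<open>auto intro: finite_PiE\<close>)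
  also have "\<dots> = card sparse_sets ^ T" by (simp add: card_PiE)
  also have "\<dots> \<le> (((b + 1) ^ (k - 1)) ^ (k * r)) ^ T" using card_sparse_sets by (intro power_mono) auto
  finally show ?thesis by (simp add: card_matchings)
qed

text \<open>Covers of the different graphs are padded to the common length
  \<open>theta_max n d k\<close>.\<close>

lemma fact_le_theta_max:
  assumes "k * b * r \<le> n" "1 \<le> n" "2 * b ^ (k - 1) \<le> d"
  shows "fact r ^ (b ^ k) \<le> (((b + 1) ^ (k - 1)) ^ (k * r)) ^ theta_max n d k"
proof (rule fact_le_covers)
  fix p assume p: "p \<in> matchings"
  have "theta k verts (edges p) \<le> theta_max n d k"
  proof (rule theta_max_ge)
    fix v assume "v \<in> verts"
    then show "card {e \<in> edges p. v \<in> e} \<le> d" using degree_edges[OF p] assms by (meson order_trans)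
  qed (use edges_kgraph[OF p] finite_verts assms k in auto)
  moreover obtain I where "covers k verts (edges p) (theta k verts (edges p)) I"
    using theta_attained(1)[OF edges_kgraph[OF p]] k by auto
  moreover have "{} \<notin> edges p"
    using edges_kgraph[OF p] k by (auto simp: kgraph_def nsets_def)
  ultimately show "\<exists>I. covers k verts (edges p) (theta_max n d k) I"
    by (intro covers_mono)
qed

end

lemma theta_max_counting:
  fixes k b r n d :: nat
  assumes "2 \<le> k" "1 \<le> b" "1 \<le> r" "k * b * r \<le> n" "2 * b ^ (k - 1) \<le> d"
  shows "real b ^ k * (ln (real r) - 1) \<le> real (theta_max n d k) * (k * (k - 1)) * ln (real b + 1)"
proof -
  interpret clique_matchings k b r by unfold_locales (rule assms(1))
  have r: "0 < real r" using assms by simp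
  have "1 \<le> k * b * r" using assms by simp
  then have n: "1 \<le> n" using assms(4) by linarith
  \<comment> \<open>\<open>r! \<ge> (r / e) ^ r\<close>: a single term of the exponential series is
    at most its sum.\<close>
  have fact_ge: "r * (ln (real r) - 1) \<le> ln (fact r)"
  proof -
    have sums: "(\<lambda>m. real r ^ m /\<^sub>R fact m) sums exp (real r)" by (rule exp_converges)
    have "(\<Sum>m\<in>{r}. real r ^ m /\<^sub>R fact m) \<le> exp (real r)"
      unfolding sums_unique[OF sums] using sums by (intro sum_le_suminf) (auto simp: sums_iff)
    then have "ln (real r ^ r / fact r) \<le> ln (exp (real r))"
      using r by (subst ln_le_cancel_iff) (auto simp: field_simps)
    then show ?thesis using r by (simp add: ln_div ln_realpow algebra_simps)
  qed
  let ?T = "theta_max n d k"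
  have "real (fact r ^ (b ^ k)) \<le> real ((((b + 1) ^ (k - 1)) ^ (k * r)) ^ ?T)"
    using fact_le_theta_max[OF assms(4) n assms(5)] by (simp only: of_nat_le_iff)
  then have "(fact r :: real) ^ (b ^ k) \<le> (((real b + 1) ^ (k - 1)) ^ (k * r)) ^ ?T"
    by (simp add: add.commute)
  then have "ln ((fact r :: real) ^ (b ^ k)) \<le> ln ((((real b + 1) ^ (k - 1)) ^ (k * r)) ^ ?T)"
    by (subst ln_le_cancel_iff) auto
  then have "real b ^ k * ln (fact r) \<le> ?T * (real (k * r) * (real (k - 1) * ln (real b + 1)))"
    by (simp add: ln_realpow)
  moreover have "real b ^ k * (r * (ln (real r) - 1)) \<le> real b ^ k * ln (fact r)"
    using fact_ge by (intro mult_left_mono) auto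
  \<comment> \<open>The number \<open>r\<close> of vertices per block appears as a factor on both
    sides and cancels, leaving only \<open>ln r\<close>.\<close>
  ultimately have "r * (real b ^ k * (ln (real r) - 1)) \<le> r * (?T * (k * (k - 1)) * ln (real b + 1))"
    by (simp add: mult_ac)
  then show ?thesis using r by (simp only: mult_le_cancel_left_pos of_nat_mult)
qed

subsection \<open>From the counting inequality to logarithmic bounds\<close>

lemma div_ge_half:
  fixes n q :: nat
  assumes "1 \<le> q" "2 * q \<le> n"
  shows "real n / (2 * real q) \<le> real (n div q)"
proof -
  have "n < q * (n div q) + q" using assms by (metis dividend_less_times_div add.commute less_eq_Suc_le One_nat_def)
  then have "real n < real q * real (n div q) + real q" by (metis of_nat_add of_nat_less_iff of_nat_mult)
  moreover have "real q \<le> real n / 2" using assms by linarith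
  ultimately have "real n / 2 \<le> real q * real (n div q)" by linarith
  then show ?thesis using assms by (simp add: field_simps)
qed

lemma ln_3_ge_1: "1 \<le> ln (3::real)"
  using exp_le by (subst ln_ge_iff) auto

text \<open>Here \<open>T\<close> stands for \<open>theta_max\<close> and \<open>D\<close> for the
  clique size that the degree allows, up to a constant. Ideally \<open>b\<close> is of order
  \<open>D\<close> and \<open>r\<close> of order \<open>n / D\<close>; if \<open>n\<close> is too
  small for this compared with \<open>D\<close>, the logarithm on the left is bounded and a smaller
  \<open>b\<close> does. \<open>D0 > 1\<close> keeps \<open>ln D\<close> away from 0.\<close>

lemma packing_lower_bound:
  fixes \<kappa> M :: nat and A D0 :: real
  assumes "1 \<le> M" "0 < A" "1 < D0"
  shows "\<exists>c>0. \<forall>(n::nat) D T. D0 \<le> D \<longrightarrow> 1 \<le> T \<longrightarrow>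
    (\<forall>b r::nat. 1 \<le> b \<longrightarrow> 1 \<le> r \<longrightarrow> M * b * r \<le> n \<longrightarrow> b = 1 \<or> 2 * real b \<le> D \<longrightarrow>
      real b ^ \<kappa> * (ln (real r) - 1) \<le> T * A * ln (real b + 1)) \<longrightarrow>
    c * (D ^ \<kappa> / ln D * ln (real n / D)) \<le> T"
proof -
  \<comment> \<open>\<open>L = (6 * M)\<^sup>2\<close>, hence
    \<open>ln L / 2 \<ge> ln (2 * M) + 1\<close>, which pays for the losses in
    \<open>ln r - 1\<close>. \<open>C\<close> compares \<open>ln (b + 1)\<close> with
    \<open>ln D\<close>, and \<open>X1\<close>, \<open>X2\<close>, \<open>X3\<close> serve the cases
    of large, bounded and intermediate \<open>n\<close>.\<close>
  define L where "L = 36 * (real M)\<^sup>2"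
  define C where "C = 1 + ln 2 / ln D0"
  define X1 where "X1 = 2 * 4 ^ \<kappa> * A * C"
  define X2 where "X2 = (2 * L) ^ \<kappa> * ln L / ln D0"
  define X3 where "X3 = (4 * L) ^ \<kappa> * A * C * ln L"
  have M: "1 \<le> real M" using assms by simp
  have M2: "real M \<le> (real M)\<^sup>2" using M by (simp add: power2_eq_square)
  have L: "36 \<le> L" "36 * real M \<le> L" using M M2 by (auto simp: L_def)
  have lnL: "0 < ln L" using L by simp
  have lnD0: "0 < ln D0" using assms by simp
  have C: "0 < C" using lnD0 by (simp add: C_def add_pos_nonneg)
  have X: "0 < X1" "0 < X2" "0 < X3"
    using L lnL lnD0 C assms by (simp_all add: X1_def X2_def X3_def)
  have main: "D ^ \<kappa> / ln D * ln (real n / D) \<le> (X1 + X2 + X3) * T"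
    if D: "D0 \<le> D" and T: "1 \<le> T"
      and H: "\<And>b r::nat. 1 \<le> b \<Longrightarrow> 1 \<le> r \<Longrightarrow> M * b * r \<le> n \<Longrightarrow> b = 1 \<or> 2 * real b \<le> D \<Longrightarrow>
        real b ^ \<kappa> * (ln (real r) - 1) \<le> T * A * ln (real b + 1)"
    for n :: nat and D T
  proof -
    have D1: "1 < D" using D assms by simp
    have lnD: "ln D0 \<le> ln D" "0 < ln D" using D assms D1 by auto
    have X_le: "x \<le> (X1 + X2 + X3) * T" if "x \<le> X1 * T \<or> x \<le> X2 * T \<or> x \<le> X3 * T" for x
    proof -
      have "0 \<le> X1 * T" "0 \<le> X2 * T" "0 \<le> X3 * T" using X T by simp_all
      then show ?thesis using that by (auto simp: algebra_simps)
    qed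
    have ln_b: "ln (real b + 1) \<le> C * ln D" if "real b \<le> D" for b
    proof -
      have "ln (real b + 1) \<le> ln (2 * D)" using that D1 by (subst ln_le_cancel_iff) auto
      also have "\<dots> = ln 2 + ln D" using D1 by (simp add: ln_mult)
      also have "ln 2 \<le> ln 2 / ln D0 * ln D"
        using lnD lnD0 by (simp add: field_simps)
      finally show ?thesis by (simp add: C_def algebra_simps)
    qed
    have step: "s ^ \<kappa> * t \<le> T * A * (C * ln D)"
      if "1 \<le> b" "1 \<le> r" "M * b * r \<le> n" "b = 1 \<or> 2 * real b \<le> D"
        "0 \<le> s" "s \<le> real b" "0 \<le> t" "t \<le> ln (real r) - 1" for b r :: nat and s t
    proof -
      have "s ^ \<kappa> * t \<le> real b ^ \<kappa> * (ln (real r) - 1)"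
        using that by (intro mult_mono power_mono) auto
      also have "\<dots> \<le> T * A * ln (real b + 1)" using that by (intro H)
      also have "\<dots> \<le> T * A * (C * ln D)"
        using that D1 T assms by (intro mult_left_mono ln_b) auto
      finally show ?thesis .
    qed
    consider "real n \<le> D" | "L * D \<le> real n" | "D < real n" "real n < L * D" "real n < 2 * L"
      | "D < real n" "real n < L * D" "2 * L \<le> real n" by linarith
    then show ?thesis
    proof cases
      case 1
      have "ln (real n / D) \<le> 0"
      proof (cases "n = 0")
        case False
        then show ?thesis using 1 D1 by (subst ln_le_zero_iff) auto
      qed simp
      then have "D ^ \<kappa> / ln D * ln (real n / D) \<le> 0"
        using D1 lnD by (intro mult_nonneg_nonpos) auto
      also have "0 \<le> (X1 + X2 + X3) * T" using X T by simp
      finally show ?thesis .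
    next
      case 2
      \<comment> \<open>The maximum with 1 covers \<open>D < 2\<close>, where only the option
        \<open>b = 1\<close> is left.\<close>
      define b where "b = max 1 (nat \<lfloor>D / 2\<rfloor>)"
      define r where "r = n div (M * b)"
      define y where "y = real n / D"
      have b: "1 \<le> b" "D / 4 \<le> real b" "real b \<le> D" "b = 1 \<or> 2 * real b \<le> D"
        using D1 unfolding b_def by linarith+
      have y: "L \<le> y" using 2 D1 by (simp add: y_def field_simps)
      have "2 * (real M * real b) \<le> L * D"
      proof -
        have "real M * real b \<le> real M * D" using b(3) M by (intro mult_left_mono) auto
        moreover have "36 * (real M * D) \<le> L * D"
          using mult_right_mono[OF L(2), of D] D1 by (simp add: mult.assoc)
        moreover have "0 \<le> real M * D" using D1 by simp
        ultimately show ?thesis by linarith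
      qed
      then have "real (2 * (M * b)) \<le> real n" using 2 by simp
      then have q: "1 \<le> M * b" "2 * (M * b) \<le> n"
        using b(1) assms(1) by (simp_all only: of_nat_le_iff) simp_all
      have "y / (2 * real M) \<le> real n / (2 * real (M * b))"
      proof -
        have "y / (2 * real M) = real n / (2 * (real M * D))" by (simp add: y_def mult_ac)
        also have "\<dots> \<le> real n / (2 * (real M * real b))"
          using b M by (intro divide_left_mono mult_left_mono) auto
        finally show ?thesis by simp
      qed
      also have "\<dots> \<le> real r" unfolding r_def using q by (rule div_ge_half)
      finally have r: "y / (2 * real M) \<le> real r" .
      have y0: "0 < y" using y L by linarith
      have r1: "1 \<le> r"
      proof -
        have "0 < y / (2 * real M)" using y0 M by simp
        then have "0 < real r" using r by linarith
        then show ?thesis by simp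
      qed
      have "ln L \<le> ln y" using y L by simp
      moreover have "ln L = 2 * ln (6 * real M)"
      proof -
        have "L = (6 * real M)\<^sup>2" by (simp add: L_def power_mult_distrib)
        moreover have "ln ((6 * real M)\<^sup>2) = real 2 * ln (6 * real M)"
          by (rule ln_realpow)
        ultimately show ?thesis by (simp only: of_nat_numeral)
      qed
      moreover have "ln (6 * real M) = ln 3 + ln (2 * real M)"
        using M ln_mult[of 3 "2 * real M"] by simp
      moreover have "ln y - ln (2 * real M) \<le> ln (real r)"
      proof -
        have "ln (y / (2 * real M)) \<le> ln (real r)" using r y0 M r1 by (subst ln_le_cancel_iff) auto
        then show ?thesis using y0 M by (simp add: ln_div)
      qed
      ultimately have lr: "ln y / 2 \<le> ln (real r) - 1" "0 \<le> ln y / 2" using ln_3_ge_1 lnL by linarith+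
      have "(D / 4) ^ \<kappa> * (ln y / 2) \<le> T * A * (C * ln D)"
        using b r1 lr D1 by (intro step[of b r]) (auto simp: r_def)
      then have "D ^ \<kappa> / ln D * ln y \<le> X1 * T"
        using lnD by (simp add: X1_def field_simps)
      then show ?thesis unfolding y_def by (intro X_le) simp
    next
      case 3
      \<comment> \<open>\<open>n\<close> and \<open>D\<close> are bounded by \<open>2 * L\<close>,
        so \<open>1 \<le> T\<close> is enough.\<close>
      have "ln (real n / D) \<le> ln L" using 3 D1 L by (subst ln_le_cancel_iff) (auto simp: field_simps)
      then have "D ^ \<kappa> / ln D * ln (real n / D) \<le> (2 * L) ^ \<kappa> / ln D0 * ln L"
        using 3 D1 lnD lnD0 by (intro mult_mono frac_le power_mono) auto
      also have "\<dots> = X2 * 1" by (simp add: X2_def)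
      also have "\<dots> \<le> X2 * T" using X T by (intro mult_left_mono) auto
      finally show ?thesis by (intro X_le) simp
    next
      case 4
      \<comment> \<open>Then \<open>D / (4 * L) \<le> b \<le> D / 2\<close>, while
        \<open>r \<ge> 36\<close> makes \<open>ln r - 1\<close> at least 1.\<close>
      define b where "b = nat \<lfloor>real n / (2 * L)\<rfloor>"
      define r where "r = n div (M * b)"
      have z: "1 \<le> real n / (2 * L)" using 4 L by (simp add: field_simps)
      have b0: "real b \<le> real n / (2 * L)" "real n / (2 * L) < real b + 1" "1 \<le> b"
        using z unfolding b_def by linarith+
      have bn: "2 * L * real b \<le> real n" using b0(1) L by (simp add: field_simps)
      have "real n / (4 * L) = real n / (2 * L) / 2" by simp
      moreover have "1 \<le> real b" using b0(3) by simp
      ultimately have "real n / (4 * L) \<le> real b" using b0(2) by linarith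
      moreover have "D / (4 * L) \<le> real n / (4 * L)" using 4 L by (intro divide_right_mono) auto
      ultimately have b1: "D / (4 * L) \<le> real b" by linarith
      have "2 * L * real b \<le> L * D" using bn 4 by linarith
      then have b2: "2 * real b \<le> D" using L by (simp add: field_simps)
      have "2 * (real M * real b) \<le> 2 * L * real b"
        using L M b0 by (simp add: mult_right_mono)
      then have "2 * (real M * real b) \<le> real n" using bn by linarith
      then have "real (2 * (M * b)) \<le> real n" by simp
      then have q: "1 \<le> M * b" "2 * (M * b) \<le> n"
        using b0(3) assms(1) by (simp_all only: of_nat_le_iff) simp_all
      have "36 * (2 * (real M * real b)) \<le> 2 * L * real b"
        using L b0 mult_right_mono[OF L(2), of "2 * real b"] by (simp add: mult_ac)
      then have "36 * (2 * real (M * b)) \<le> real n" using bn by simp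
      moreover have "0 < 2 * real (M * b)" using q(1) by simp
      ultimately have "36 \<le> real n / (2 * real (M * b))" by (simp only: pos_le_divide_eq)
      also have "\<dots> \<le> real r" unfolding r_def using q by (rule div_ge_half)
      finally have r: "36 \<le> real r" .
      have "2 * ln (3::real) = ln 9" using ln_realpow[of 3 2] by simp
      moreover have "ln 9 \<le> ln (real r)" using r by simp
      ultimately have lr: "1 \<le> ln (real r) - 1" using ln_3_ge_1 by linarith
      have "(D / (4 * L)) ^ \<kappa> * 1 \<le> T * A * (C * ln D)"
        using b0(3) b1 b2 r lr D1 L by (intro step[of b r]) (auto simp: r_def)
      then have "D ^ \<kappa> / ln D \<le> (4 * L) ^ \<kappa> * A * C * T"
        using lnD L by (simp add: field_simps)
      moreover have "ln (real n / D) \<le> ln L" using 4 D1 L by (subst ln_le_cancel_iff) (auto simp: field_simps)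
      moreover have "0 \<le> ln (real n / D)" using 4 D1 by simp
      ultimately have "D ^ \<kappa> / ln D * ln (real n / D) \<le> ((4 * L) ^ \<kappa> * A * C * T) * ln L"
        using assms T C L by (intro mult_mono) auto
      then show ?thesis by (intro X_le) (simp add: X3_def mult_ac)
    qed
  qed
  show ?thesis
  proof (intro exI[of _ "1 / (X1 + X2 + X3)"] conjI allI impI)
    show "0 < 1 / (X1 + X2 + X3)" using X by simp
    fix n :: nat and D T
    assume "D0 \<le> D" "1 \<le> T" "\<forall>b r::nat. 1 \<le> b \<longrightarrow> 1 \<le> r \<longrightarrow> M * b * r \<le> n \<longrightarrow> b = 1 \<or> 2 * real b \<le> D \<longrightarrow>
      real b ^ \<kappa> * (ln (real r) - 1) \<le> T * A * ln (real b + 1)"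
    then have "D ^ \<kappa> / ln D * ln (real n / D) \<le> T * (X1 + X2 + X3)"
      by (subst mult.commute, intro main) auto
    moreover have "0 < X1 + X2 + X3" using X by simp
    ultimately have "(D ^ \<kappa> / ln D * ln (real n / D)) / (X1 + X2 + X3) \<le> T"
      by (simp only: pos_divide_le_eq)
    then show "1 / (X1 + X2 + X3) * (D ^ \<kappa> / ln D * ln (real n / D)) \<le> T"
      by (simp only: times_divide_eq_left mult_1)
  qed
qed

section \<open>Bounds with constants depending on \<open>k\<close> only\<close>

lemma theta_max_ge_1:
  assumes "1 \<le> n" "1 \<le> k"
  shows "1 \<le> theta_max n d k"
proof -
  obtain V :: "nat set" and E where "kgraph k V E" "theta k V E = theta_max n d k"
    using theta_max_witness[OF assms, of d] by blast
  then show ?thesis using theta_attained(1)[of k V E] assms by auto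
qed

lemma theta_max_upper:
  assumes k: "3 \<le> k"
  shows "\<exists>c>0. \<forall>n d. 3 \<le> n \<longrightarrow> 1 \<le> d \<longrightarrow>
    real (theta_max n d k) \<le> c * real d powr (real k / 2) * ln (real n)"
proof -
  define P where "P = 1 + real k + real k ^ 3"
  \<comment> \<open>Chosen so that \<open>1 / N\<close> solves the equation that
    \<open>theta_upper\<close> asks of \<open>\<epsilon>\<close>.\<close>
  define N where "N = 6 * real k * (2 ^ k * P)"
  define \<epsilon> where "\<epsilon> = 1 / N"
  have P: "1 \<le> P" by (simp add: P_def)
  then have "1 * 1 \<le> 6 * real k * (2 ^ k * P)"
    using k by (intro mult_mono mult_ge1_I) auto
  then have N: "1 \<le> N" by (simp add: N_def)
  have \<epsilon>: "0 < \<epsilon>" "\<epsilon> \<le> 1" using N by (simp_all add: \<epsilon>_def)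
  have "2 ^ k * (P * \<epsilon>) = 1 / (6 * real k)"
    using P k unfolding \<epsilon>_def N_def by (simp add: field_simps)
  then have \<epsilon>3: "2 ^ k * ((1 + real k + real k ^ 3) * \<epsilon>) = 1 / real (6 * k)"
    by (simp only: P_def of_nat_mult of_nat_numeral)
  have "real (theta_max n d k) \<le> 2 * (real k + 1) / \<epsilon> ^ k * real d powr (real k / 2) * ln (real n)"
    if n: "3 \<le> n" and d: "1 \<le> d" for n d
  proof -
    obtain V :: "nat set" and E where G: "kgraph k V E" "card V = n" "theta k V E = theta_max n d k"
      "\<forall>v\<in>V. card {e \<in> E. v \<in> e} \<le> d"
      using theta_max_witness[of n k d] n k by auto
    interpret sparse_kgraph k V E d
      using G k d by unfold_locales (auto simp: kgraph_def)
    show ?thesis using theta_upper[OF \<epsilon> \<epsilon>3 G(2) n] G(3) by (simp add: algebra_simps)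
  qed
  moreover have "0 < 2 * (real k + 1) / \<epsilon> ^ k" using \<epsilon> by simp
  ultimately show ?thesis by blast
qed

text \<open>With \<open>D\<close> equal to \<open>d\<close> to the power \<open>1 / (k - 1)\<close>,
  cliques on \<open>b \<le> D / 2\<close> vertices respect the degree bound, and the factors
  \<open>k - 1\<close> in \<open>ln D\<close> and in the last logarithm cancel.\<close>

lemma theta_max_lower:
  assumes k: "2 \<le> k"
  shows "\<exists>c>0. \<forall>n d. 1 \<le> n \<longrightarrow> 3 \<le> d \<longrightarrow>
    c * (real d powr (real k / (real k - 1)) / ln (real d) * ln (real n ^ (k - 1) / real d))
      \<le> real (theta_max n d k)"
proof -
  let ?e = "1 / (real k - 1)"
  have e: "0 < ?e" using k by simp
  have km: "real (k - 1) = real k - 1" using k by (simp add: of_nat_diff)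
  have e3: "(1::real) < 3 powr ?e" using e by (intro gr_one_powr) auto
  obtain c where c: "0 < c" and H: "\<And>(n::nat) D T. 3 powr ?e \<le> D \<Longrightarrow> 1 \<le> T \<Longrightarrow>
    \<forall>b r::nat. 1 \<le> b \<longrightarrow> 1 \<le> r \<longrightarrow> k * b * r \<le> n \<longrightarrow> b = 1 \<or> 2 * real b \<le> D \<longrightarrow>
      real b ^ k * (ln (real r) - 1) \<le> T * real (k * (k - 1)) * ln (real b + 1) \<Longrightarrow>
    c * (D ^ k / ln D * ln (real n / D)) \<le> T"
  proof -
    have "1 \<le> k" "0 < real (k * (k - 1))" using k by auto
    from packing_lower_bound[OF this e3, of k] show thesis using that by blast
  qed
  have "c * (real d powr (real k / (real k - 1)) / ln (real d) * ln (real n ^ (k - 1) / real d))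
      \<le> real (theta_max n d k)" if n: "1 \<le> n" and d: "3 \<le> d" for n d
  proof -
    define D where "D = real d powr ?e"
    have D: "3 powr ?e \<le> D" "0 < D" using d e unfolding D_def by (auto intro: powr_mono2)
    have Dk: "D ^ (k - 1) = real d" "D ^ k = real d powr (real k / (real k - 1))"
    proof -
      have "D ^ m = real d powr (real m / (real k - 1))" for m
        using D(2) by (simp add: D_def powr_powr flip: powr_realpow)
      then show "D ^ (k - 1) = real d" "D ^ k = real d powr (real k / (real k - 1))"
        using k d by (auto simp: km)
    qed
    have lnD: "ln D = ln (real d) / (real k - 1)" using d by (simp add: D_def ln_powr)
    have lnnD: "ln (real n ^ (k - 1) / real d) = (real k - 1) * ln (real n / D)"
    proof -
      have "real n ^ (k - 1) / real d = (real n / D) ^ (k - 1)" by (simp only: power_divide Dk(1))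
      then show ?thesis by (simp only: ln_realpow km)
    qed
    have "c * (D ^ k / ln D * ln (real n / D)) \<le> real (theta_max n d k)"
    proof (rule H[OF D(1)], goal_cases)
      case 1
      show ?case using theta_max_ge_1[of n k d] n k by simp
    next
      case 2
      show ?case
      proof (intro allI impI)
        fix b r :: nat
        assume b: "1 \<le> b" "1 \<le> r" "k * b * r \<le> n" "b = 1 \<or> 2 * real b \<le> D"
        \<comment> \<open>For \<open>b = 1\<close> the claim is \<open>2 \<le> d\<close>; otherwise
          \<open>2 * b ^ (k - 1) \<le> (2 * b) ^ (k - 1)\<close> absorbs the factor 2.\<close>
        have "2 * b ^ (k - 1) \<le> d"
          using b(4)
        proof
          assume "2 * real b \<le> D"
          then have "(2 * real b) ^ (k - 1) \<le> real d" using Dk(1) power_mono[of "2 * real b" D "k - 1"] by simp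
          then have "real ((2 * b) ^ (k - 1)) \<le> real d" by simp
          then have "(2 * b) ^ (k - 1) \<le> d" by (simp only: of_nat_le_iff)
          moreover have "(2::nat) ^ 1 \<le> 2 ^ (k - 1)" using k by (intro power_increasing) auto
          then have "2 * b ^ (k - 1) \<le> (2 * b) ^ (k - 1)" by (simp add: power_mult_distrib)
          ultimately show ?thesis by linarith
        qed (use d in simp)
        then show "real b ^ k * (ln (real r) - 1)
            \<le> real (theta_max n d k) * real (k * (k - 1)) * ln (real b + 1)"
          using theta_max_counting[OF k b(1,2,3)] by simp
      qed
    qed
    moreover have "real d powr (real k / (real k - 1)) / ln (real d) * ln (real n ^ (k - 1) / real d)
        = D ^ k / ln D * ln (real n / D)"
      using k unfolding lnD lnnD Dk(2) by simp
    ultimately show ?thesis by simp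
  qed
  then show ?thesis using c by blast
qed

text \<open>Counting for 2-graphs on \<open>n div K\<close> vertices, followed by a blow-up with
  \<open>K = k div 2\<close>. The packing condition \<open>2 * b * r \<le> n div K\<close> amounts
  to \<open>k * b * r \<le> n\<close>.\<close>

lemma theta_max_lower_even:
  assumes k: "2 \<le> k" "even k"
  shows "\<exists>c>0. \<forall>n d. 1 \<le> n \<longrightarrow> 3 \<le> d \<longrightarrow>
    c * ((real d)\<^sup>2 / ln (real d) * ln (real n / real d)) \<le> real (theta_max n d k)"
proof -
  define K where "K = k div 2"
  have K: "1 \<le> K" "K * 2 = k" using k by (auto simp: K_def)
  obtain c where c: "0 < c" and H: "\<And>(n::nat) D T. 3 \<le> D \<Longrightarrow> 1 \<le> T \<Longrightarrow>
    \<forall>b r::nat. 1 \<le> b \<longrightarrow> 1 \<le> r \<longrightarrow> k * b * r \<le> n \<longrightarrow> b = 1 \<or> 2 * real b \<le> D \<longrightarrow>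
      real b ^ 2 * (ln (real r) - 1) \<le> T * 2 * ln (real b + 1) \<Longrightarrow>
    c * (D ^ 2 / ln D * ln (real n / D)) \<le> T"
  proof -
    have "1 \<le> k" "(0::real) < 2" "(1::real) < 3" using k by auto
    from packing_lower_bound[OF this, of 2] show thesis using that by blast
  qed
  have "c * ((real d)\<^sup>2 / ln (real d) * ln (real n / real d)) \<le> real (theta_max n d k)"
    if n: "1 \<le> n" and d: "3 \<le> d" for n d
  proof (rule H, goal_cases)
    case 1
    show ?case using d by simp
  next
    case 2
    show ?case using theta_max_ge_1[of n k d] n k by simp
  next
    case 3
    show ?case
    proof (intro allI impI)
      fix b r :: nat
      assume b: "1 \<le> b" "1 \<le> r" "k * b * r \<le> n" "b = 1 \<or> 2 * real b \<le> real d"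
      have "K * (2 * b * r) \<le> n" using b(3) K(2) by (simp add: mult.assoc[symmetric])
      then have br: "2 * b * r \<le> n div K"
        using K(1) by (simp add: less_eq_div_iff_mult_less_eq mult.commute)
      moreover have "1 * 1 \<le> b * r" using b by (intro mult_mono) auto
      ultimately have "1 \<le> n div K" by linarith
      then have "theta_max (n div K) d 2 \<le> theta_max n d k"
        using theta_max_blowup[of K "n div K" 2 n d] K by simp
      moreover have "2 * b ^ (2 - 1) \<le> d" using b(4) d by auto
      then have "real b ^ 2 * (ln (real r) - 1) \<le> real (theta_max (n div K) d 2) * 2 * ln (real b + 1)"
        using theta_max_counting[of 2 b r "n div K" d] b br by simp
      ultimately show "real b ^ 2 * (ln (real r) - 1) \<le> real (theta_max n d k) * 2 * ln (real b + 1)"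
        by (elim order_trans) (auto intro!: mult_right_mono)
    qed
  qed
  then show ?thesis using c by blast
qed

theorem theorem2p2:
  fixes k :: nat
  assumes "k \<ge> 3"
  shows "\<exists>c1 c2 :: real. c1 > 0 \<and> c2 > 0 \<and>
    (\<forall>n d :: nat. n \<ge> 3 \<longrightarrow> d \<ge> 3 \<longrightarrow>
      c1 * (real d powr (real k / (real k - 1)) / ln (real d)) * ln (real n ^ (k - 1) / real d)
        \<le> real (theta_max n d k) \<and>
      real (theta_max n d k) \<le> c2 * real d powr (real k / 2) * ln (real n) \<and>
      (even k \<longrightarrow>
        c1 * (real d)\<^sup>2 / ln (real d) * ln (real n / real d) \<le> real (theta_max n d k)))"
proof -
  have k: "2 \<le> k" using assms by simp
  obtain c2 where c2: "0 < c2" "\<And>n d. 3 \<le> n \<Longrightarrow> 1 \<le> d \<Longrightarrow>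
      real (theta_max n d k) \<le> c2 * real d powr (real k / 2) * ln (real n)"
    using theta_max_upper[OF assms] by blast
  obtain a where a: "0 < a" "\<And>n d. 1 \<le> n \<Longrightarrow> 3 \<le> d \<Longrightarrow>
      a * (real d powr (real k / (real k - 1)) / ln (real d) * ln (real n ^ (k - 1) / real d))
      \<le> real (theta_max n d k)"
    using theta_max_lower[OF k] by blast
  \<comment> \<open>For odd \<open>k\<close> the last bound is vacuous and any positive constant
    will do.\<close>
  obtain a' where a': "0 < a'" "\<And>n d. even k \<Longrightarrow> 1 \<le> n \<Longrightarrow> 3 \<le> d \<Longrightarrow>
      a' * ((real d)\<^sup>2 / ln (real d) * ln (real n / real d)) \<le> real (theta_max n d k)"
    using theta_max_lower_even[OF k] zero_less_one by blast
  define c1 where "c1 = min a a'"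
  have c1: "0 < c1" "c1 \<le> a" "c1 \<le> a'" using a a' by (auto simp: c1_def)
  \<comment> \<open>The logarithms may be negative; then the bound holds for any positive constant,
    since \<open>theta_max\<close> is not negative.\<close>
  have weaken: "c1 * x \<le> t" if "c1 \<le> c" "c * x \<le> t" "0 \<le> t" for c x t :: real
  proof (cases "0 \<le> x")
    case True
    then show ?thesis using that mult_right_mono[of c1 c x] by linarith
  next
    case False
    then have "c1 * x \<le> 0" using c1(1) by (simp add: mult_nonneg_nonpos)
    then show ?thesis using that by linarith
  qed
  show ?thesis
  proof (rule exI[of _ c1], rule exI[of _ c2], intro conjI allI impI)
    fix n d :: nat assume n: "3 \<le> n" and d: "3 \<le> d"
    show "c1 * (real d powr (real k / (real k - 1)) / ln (real d)) * ln (real n ^ (k - 1) / real d)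
        \<le> real (theta_max n d k)"
      using weaken[OF c1(2) a(2)[of n d]] n d by (simp add: mult.assoc)
    show "real (theta_max n d k) \<le> c2 * real d powr (real k / 2) * ln (real n)"
      using c2(2) n d by simp
    assume "even k"
    then show "c1 * (real d)\<^sup>2 / ln (real d) * ln (real n / real d) \<le> real (theta_max n d k)"
      using weaken[OF c1(3) a'(2)[of n d]] n d by (simp add: mult.assoc)
  qed (use c1 c2 in auto)
qed

end
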